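(* Assume that: (i) for each $i$, $X_i$ is convex, $f_i$ and every component of $g_i$ are convex on $X_i$, $h_i$ is affine on $X_i$, and problem (CC) has at least one optimal solution; (ii) (Slater) there exist $\tilde x_i\in\mathrm{relint}\,X_i$, $i=1,\dots,N$, with $\sum_{i=1}^N g_i(\tilde x_i)<\mathbf 0_m$ (componentwise) and $\sum_{i=1}^N h_i(\tilde x_i)=\mathbf 0_p$; (iii) $P_A,P_H,P_{\tilde H}\in\mathbb R^{N\times N}$ are symmetric positive semidefinite with $P_A+\rho P_H\succ 0$, $P_H\succeq P_{\tilde H}$ and $\mathrm{Null}(P_H)=\mathrm{Null}(P_{\tilde H})=\mathrm{span}(\mathbf 1_N)$; (iv) $P_A+\rho P_H$ is diagonal. Let $\{\mathbf x^k,\mathbf y^k,\mathbf z^k\}_{k\ge0}$ be generated by Pro-DUCA. Then for all $k\ge1$, $$\left\|\begin{bmatrix}\big[\sum_{i=1}^N g_i(\bar x_i^k)\big]_+\\ \sum_{i=1}^N h_i(\bar x_i^k)\end{bmatrix}\right\|\le \frac{\sqrt{N\lambda_1(P_A)}}{k}\Big(\|\mathbf y^0\|_A+C_1+C_2\Big),$$ where $C_1=\sqrt{N\lambda_1(P_A)}\,\|y^\star\|$ and $C_2=\Big((\|\mathbf y^0\|_A+C_1)^2+\alpha\|\mathbf x^0-\mathbf x^\star\|^2+\frac1\rho\|\mathbf v^0-\mathbf v^\star\|_{\tilde H^\dagger}^2\Big)^{1/2}$.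
   Context: Problem (CC): minimize $\sum_{i=1}^N f_i(x_i)$ over $x_i\in X_i\subseteq\mathbb R^{d_i}$, $i=1,\dots,N$, subject to $\sum_{i=1}^N g_i(x_i)\le\mathbf 0_m$ and $\sum_{i=1}^N h_i(x_i)=\mathbf 0_p$, where $f_i:\mathbb R^{d_i}\to\mathbb R$, $g_i:\mathbb R^{d_i}\to\mathbb R^m$, $h_i:\mathbb R^{d_i}\to\mathbb R^p$. Write $\mathbf x=[x_1^T,\dots,x_N^T]^T$, $X=X_1\times\dots\times X_N$, $f(\mathbf x)=\sum_i f_i(x_i)$, $\tilde g(\mathbf x)=[g_1(x_1)^T,h_1(x_1)^T,\dots,g_N(x_N)^T,h_N(x_N)^T]^T\in\mathbb R^{N(m+p)}$. Under (i)-(ii) there exists a primal-dual optimal pair $(\mathbf x^\star,(\mu^\star,\lambda^\star))$ with $\mu^\star\in\mathbb R^m_+$, $\lambda^\star\in\mathbb R^p$: $\mathbf x^\star$ is optimal for (CC), $(\mu^\star,\lambda^\star)$ is optimal for the Lagrange dual (maximize $\inf_{\mathbf x\in X}f(\mathbf x)+\langle\mu,\sum_i g_i(x_i)\rangle+\langle\lambda,\sum_i h_i(x_i)\rangle$ over $\mu\in\mathbb R^m_+$, $\lambda\in\mathbb R^p$), there is zero duality gap, and $\mathbf x^\star\in\arg\min_{\mathbf x\in X}f(\mathbf x)+\langle\mu^\star,\sum_i g_i(x_i)\rangle+\langle\lambda^\star,\sum_i h_i(x_i)\rangle$. Fix such a pair. Vectors $\mathbf y\in\mathbb R^{N(m+p)}$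 are partitioned as $\mathbf y=[y_1^T,\dots,y_N^T]^T$, $y_i=[\mu_i^T,\lambda_i^T]^T$, $\mu_i\in\mathbb R^m$, $\lambda_i\in\mathbb R^p$; $\mathcal K=\{\mathbf y:\mu_i\in\mathbb R^m_+\ \forall i\}$. $\mathcal P_{\mathcal K}$ is Euclidean projection onto $\mathcal K$, $[\cdot]_+$ is the componentwise positive part. $\rho>0$ and $\alpha>0$ are parameters; $A=P_A\otimes I_{m+p}$, $H=P_H\otimes I_{m+p}$, $\tilde H=P_{\tilde H}\otimes I_{m+p}$, $D=A+\rho H$. $\|\cdot\|$ is the Euclidean norm, $\|z\|_M=\sqrt{z^TMz}$ for symmetric positive semidefinite $M$, $M^\dagger$ is the Moore–Penrose pseudoinverse, $\lambda_1(\cdot)$ is the largest eigenvalue. Pro-DUCA: from arbitrary $\mathbf x^0\in\mathbb R^{\sum_i d_i}$, $\mathbf y^0\in\mathcal K$, $\mathbf z^0\in\mathbb R^{N(m+p)}$, for $k\ge0$: $\mathbf x^{k+1}=\arg\min_{\mathbf x\in X}\{f(\mathbf x)+\frac12\|\mathcal P_{\mathcal K}[A\mathbf y^k-\tilde H^{1/2}\mathbf z^k+\tilde g(\mathbf x)]\|_{D^{-1}}^2+\frac\alpha2\|\mathbf x-\mathbf x^k\|^2\}$; $\mathbf y^{k+1}=\mathcal P_{\mathcal K}[D^{-1}(A\mathbf y^k-\tilde H^{1/2}\mathbf z^k+\tilde g(\mathbf x^{k+1}))]$; $\mathbf z^{k+1}=\mathbf z^k+\rho\tilde H^{1/2}\mathbf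 y^{k+1}$. Further notation: $y^\star=[(\mu^\star)^T,(\lambda^\star)^T]^T$, $\mathbf z^\star=(\tilde H^{1/2})^\dagger\tilde g(\mathbf x^\star)$, $\mathbf v^k=\tilde H^{1/2}\mathbf z^k$, $\mathbf v^\star=\tilde H^{1/2}\mathbf z^\star$, $\bar{\mathbf x}^k=\frac1k\sum_{l=1}^k\mathbf x^l$ with blocks $\bar x_i^k$. *)

theory Defs
  imports "HOL-Analysis.Analysis"
begin

section \<open>Real matrices\<close>

definition sym_psd :: "real^'n^'n \<Rightarrow> bool" where
  "sym_psd M \<longleftrightarrow> transpose M = M \<and> (\<forall>v. 0 \<le> v \<bullet> (M *v v))"

definition sym_pd :: "real^'n^'n \<Rightarrow> bool" where
  "sym_pd M \<longleftrightarrow> transpose M = M \<and> (\<forall>v. v \<noteq> 0 \<longrightarrow> 0 < v \<bullet> (M *v v))"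

definition diag_mat :: "real^'n^'n \<Rightarrow> bool" where
  "diag_mat M \<longleftrightarrow> (\<forall>i j. i \<noteq> j \<longrightarrow> M $ i $ j = 0)"

definition null_sp :: "real^'n^'m \<Rightarrow> (real^'n) set" where
  "null_sp M = {v. M *v v = 0}"

definition kron :: "real^'b^'a \<Rightarrow> real^'d^'c \<Rightarrow> real^('b \<times> 'd)^('a \<times> 'c)" where
  "kron P Q = (\<chi> r s. P $ fst r $ fst s * Q $ snd r $ snd s)"

text \<open>The positive semidefinite square root; meaningful when \<open>M\<close> is symmetric positive semidefinite.\<close>

definition psd_sqrt :: "real^'n^'n \<Rightarrow> real^'n^'n" where
  "psd_sqrt M = (THE S. sym_psd S \<and> S ** S = M)"

text \<open>The Moore--Penrose pseudoinverse, given by the four Penrose equations.\<close>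

definition pinv :: "real^'n^'m \<Rightarrow> real^'m^'n" where
  "pinv M = (THE B. M ** B ** M = M \<and> B ** M ** B = B \<and>
                    transpose (M ** B) = M ** B \<and> transpose (B ** M) = B ** M)"

text \<open>The largest eigenvalue; meaningful when \<open>M\<close> is symmetric, so that it has a real eigenvalue.\<close>

definition max_eigenvalue :: "real^'n^'n \<Rightarrow> real" where
  "max_eigenvalue M = Max {c. \<exists>v. v \<noteq> 0 \<and> M *v v = c *\<^sub>R v}"

definition wnorm :: "real^'n^'n \<Rightarrow> real^'n \<Rightarrow> real" where
  "wnorm M v = sqrt (v \<bullet> (M *v v))"

section \<open>The coupled convex problem and its Lagrange dual\<close>

text \<open>
  The agents are indexed by the finite type \<open>'n\<close>, so \<open>N = CARD('n)\<close>. The dimensions \<open>d\<^sub>i\<close> may differ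
  from agent to agent: \<open>\<real>\<^bsup>d\<^sub>i\<^esup>\<close> is the coordinate subspace \<open>coord_space (J i)\<close> of a common
  \<open>real^'d\<close>, where \<open>d\<^sub>i = card (J i)\<close>. A stacked vector is an element of \<open>real^'d^'n\<close> with
  blocks \<open>x $ i\<close>. Relative interiors, Euclidean norms and inner products computed in the ambient
  space agree with those of the subspaces.
\<close>

definition coord_space :: "'d::finite set \<Rightarrow> (real^'d) set" where
  "coord_space C = {v. \<forall>j. j \<notin> C \<longrightarrow> v $ j = 0}"

definition blocks :: "('n::finite \<Rightarrow> (real^'d) set) \<Rightarrow> (real^'d^'n) set" where
  "blocks X = {x. \<forall>i. x $ i \<in> X i}"

definition agent_sum :: "('n::finite \<Rightarrow> real^'d \<Rightarrow> 'b::comm_monoid_add) \<Rightarrow> real^'d^'n \<Rightarrow> 'b" where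
  "agent_sum F x = (\<Sum>i\<in>UNIV. F i (x $ i))"

definition affine_map_on :: "'a::real_vector set \<Rightarrow> ('a \<Rightarrow> 'b::real_vector) \<Rightarrow> bool" where
  "affine_map_on S F \<longleftrightarrow> (\<exists>L c. linear L \<and> (\<forall>x\<in>S. F x = L x + c))"

definition nonneg :: "real^'m \<Rightarrow> bool" where
  "nonneg v \<longleftrightarrow> (\<forall>a. 0 \<le> v $ a)"

definition cc_feasible ::
  "('n::finite \<Rightarrow> (real^'d) set) \<Rightarrow> ('n \<Rightarrow> real^'d \<Rightarrow> real^'m) \<Rightarrow> ('n \<Rightarrow> real^'d \<Rightarrow> real^'p)
    \<Rightarrow> real^'d^'n \<Rightarrow> bool" where
  "cc_feasible X g h x \<longleftrightarrow>
     x \<in> blocks X \<and> (\<forall>a. agent_sum g x $ a \<le> 0) \<and> agent_sum h x = 0"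

definition cc_optimal ::
  "('n::finite \<Rightarrow> (real^'d) set) \<Rightarrow> ('n \<Rightarrow> real^'d \<Rightarrow> real) \<Rightarrow> ('n \<Rightarrow> real^'d \<Rightarrow> real^'m)
    \<Rightarrow> ('n \<Rightarrow> real^'d \<Rightarrow> real^'p) \<Rightarrow> real^'d^'n \<Rightarrow> bool" where
  "cc_optimal X f g h x \<longleftrightarrow> is_arg_min (agent_sum f) (cc_feasible X g h) x"

definition slater ::
  "('n::finite \<Rightarrow> (real^'d) set) \<Rightarrow> ('n \<Rightarrow> real^'d \<Rightarrow> real^'m) \<Rightarrow> ('n \<Rightarrow> real^'d \<Rightarrow> real^'p) \<Rightarrow> bool" where
  "slater X g h \<longleftrightarrow>
     (\<exists>x. (\<forall>i. x $ i \<in> rel_interior (X i)) \<and> (\<forall>a. agent_sum g x $ a < 0) \<and> agent_sum h x = 0)"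

definition lagrangian ::
  "('n::finite \<Rightarrow> real^'d \<Rightarrow> real) \<Rightarrow> ('n \<Rightarrow> real^'d \<Rightarrow> real^'m) \<Rightarrow> ('n \<Rightarrow> real^'d \<Rightarrow> real^'p)
    \<Rightarrow> real^'d^'n \<Rightarrow> real^'m \<Rightarrow> real^'p \<Rightarrow> real" where
  "lagrangian f g h x \<mu> lam = agent_sum f x + \<mu> \<bullet> agent_sum g x + lam \<bullet> agent_sum h x"

text \<open>The dual function is extended-real valued, as the infimum may be \<open>-\<infinity>\<close>.\<close>

definition dual_fun ::
  "('n::finite \<Rightarrow> (real^'d) set) \<Rightarrow> ('n \<Rightarrow> real^'d \<Rightarrow> real) \<Rightarrow> ('n \<Rightarrow> real^'d \<Rightarrow> real^'m)
    \<Rightarrow> ('n \<Rightarrow> real^'d \<Rightarrow> real^'p) \<Rightarrow> (real^'m) \<times> (real^'p) \<Rightarrow> ereal" where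
  "dual_fun X f g h = (\<lambda>(\<mu>, lam). INF x\<in>blocks X. ereal (lagrangian f g h x \<mu> lam))"

definition primal_dual_optimal ::
  "('n::finite \<Rightarrow> (real^'d) set) \<Rightarrow> ('n \<Rightarrow> real^'d \<Rightarrow> real) \<Rightarrow> ('n \<Rightarrow> real^'d \<Rightarrow> real^'m)
    \<Rightarrow> ('n \<Rightarrow> real^'d \<Rightarrow> real^'p) \<Rightarrow> real^'d^'n \<Rightarrow> real^'m \<Rightarrow> real^'p \<Rightarrow> bool" where
  "primal_dual_optimal X f g h x \<mu> lam \<longleftrightarrow>
     cc_optimal X f g h x \<and>
     is_arg_max (dual_fun X f g h) (\<lambda>(\<mu>', lam'). nonneg \<mu>') (\<mu>, lam) \<and>
     ereal (agent_sum f x) = dual_fun X f g h (\<mu>, lam) \<and>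
     is_arg_min (\<lambda>x'. lagrangian f g h x' \<mu> lam) (\<lambda>x'. x' \<in> blocks X) x"

section \<open>Pro-DUCA\<close>

text \<open>
  A vector in \<open>\<real>\<^bsup>N(m+p)\<^esup>\<close> is an element of \<open>real^('n \<times> ('m + 'p))\<close>: index \<open>(i, Inl a)\<close> is the
  \<open>a\<close>-th entry of \<open>\<mu>\<^sub>i\<close>, index \<open>(i, Inr b)\<close> the \<open>b\<close>-th entry of \<open>\<lambda>\<^sub>i\<close>.
\<close>

definition stack :: "real^'m \<Rightarrow> real^'p \<Rightarrow> real^('m::finite + 'p::finite)" where
  "stack u w = (\<chi> c. case c of Inl a \<Rightarrow> u $ a | Inr b \<Rightarrow> w $ b)"

definition g_tilde ::
  "('n::finite \<Rightarrow> real^'d \<Rightarrow> real^'m) \<Rightarrow> ('n \<Rightarrow> real^'d \<Rightarrow> real^'p) \<Rightarrow> real^'d^'n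
    \<Rightarrow> real^('n \<times> ('m + 'p))" where
  "g_tilde g h x = (\<chi> r. stack (g (fst r) (x $ fst r)) (h (fst r) (x $ fst r)) $ snd r)"

definition pos_part :: "real^'m \<Rightarrow> real^'m" where
  "pos_part v = (\<chi> a. max 0 (v $ a))"

definition dual_cone :: "(real^('n::finite \<times> ('m::finite + 'p::finite))) set" where
  "dual_cone = {y. \<forall>i a. 0 \<le> y $ (i, Inl a)}"

definition lift_mat :: "real^'n^'n \<Rightarrow> real^('n \<times> 'q::finite)^('n \<times> 'q)" where
  "lift_mat P = kron P (mat 1)"

definition pro_duca ::
  "('n::finite \<Rightarrow> 'd::finite set) \<Rightarrow> ('n \<Rightarrow> (real^'d) set) \<Rightarrow> ('n \<Rightarrow> real^'d \<Rightarrow> real) \<Rightarrow> ('n \<Rightarrow> real^'d \<Rightarrow> real^'m)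
    \<Rightarrow> ('n \<Rightarrow> real^'d \<Rightarrow> real^'p) \<Rightarrow> real^'n^'n \<Rightarrow> real^'n^'n \<Rightarrow> real^'n^'n \<Rightarrow> real \<Rightarrow> real
    \<Rightarrow> (nat \<Rightarrow> real^'d^'n) \<Rightarrow> (nat \<Rightarrow> real^('n \<times> ('m + 'p))) \<Rightarrow> (nat \<Rightarrow> real^('n \<times> ('m + 'p)))
    \<Rightarrow> bool" where
  "pro_duca J X f g h P\<^sub>A P\<^sub>H P\<^sub>H\<^sub>t \<rho> \<alpha> x y z \<longleftrightarrow>
    (let A = lift_mat P\<^sub>A; H = lift_mat P\<^sub>H; D = A + \<rho> *\<^sub>R H; S = psd_sqrt (lift_mat P\<^sub>H\<^sub>t) in
      x 0 \<in> blocks (\<lambda>i. coord_space (J i)) \<and> y 0 \<in> dual_cone \<and>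
      (\<forall>k.
        is_arg_min
          (\<lambda>x'. agent_sum f x'
            + 1/2 * (wnorm (matrix_inv D)
                (closest_point dual_cone (A *v y k - S *v z k + g_tilde g h x')))\<^sup>2
            + \<alpha>/2 * (norm (x' - x k))\<^sup>2)
          (\<lambda>x'. x' \<in> blocks X) (x (Suc k)) \<and>
        y (Suc k) = closest_point dual_cone
          (matrix_inv D *v (A *v y k - S *v z k + g_tilde g h (x (Suc k)))) \<and>
        z (Suc k) = z k + \<rho> *\<^sub>R (S *v y (Suc k))))"

definition running_avg :: "(nat \<Rightarrow> 'a::real_vector) \<Rightarrow> nat \<Rightarrow> 'a" where
  "running_avg x k = (1 / real k) *\<^sub>R (\<Sum>l=1..k. x l)"

end

theory Submission
  imports Defs
begin

text \<open>
  Let \<open>Y = consensus (stack \<mu>\<^sub>s lam\<^sub>s)\<close> be the optimal multiplier copied to every agent. First-order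
  optimality of the primal step makes \<open>y (Suc j)\<close> act as a multiplier for \<open>x (Suc j)\<close>; together with
  the saddle inequality for \<open>Y\<close> this gives monotonicity of the residual \<open>g_tilde\<close> between \<open>(x, y)\<close> and
  \<open>(x\<^sub>s, Y)\<close>. As \<open>D\<close> is diagonal, projecting onto the cone means
  \<open>D y\<^sup>+ = A y - S z + g_tilde x\<^sup>+ + s\<close> with a slack \<open>s\<close> in the cone that is orthogonal to \<open>y\<^sup>+\<close>.
  Hence \<open>\<parallel>y - Y\<parallel>\<^sub>A\<^sup>2 + \<alpha> \<parallel>x - x\<^sub>s\<parallel>\<^sup>2 + \<parallel>v - v\<^sub>s\<parallel>\<^sup>2 / \<rho>\<close> does not increase, where the last norm is weighted by
  the pseudoinverse. Summing the slack equation over the agents cancels the \<open>H\<close> and \<open>S\<close> terms, so the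
  accumulated constraint violation telescopes to at most the agent sum of \<open>A (y\<^sup>k - y\<^sup>0)\<close>, which is
  controlled by \<open>\<parallel>y\<^sup>k - y\<^sup>0\<parallel>\<^sub>A\<close>.
\<close>

section \<open>Spectral calculus for symmetric matrices\<close>

lemma symmetric_matrix_inner:
  fixes M :: "real^'n^'n"
  assumes "transpose M = M"
  shows "(M *v u) \<bullet> w = u \<bullet> (M *v w)"
  by (metis assms dot_lmul_matrix transpose_matrix_vector)

text \<open>The maximizer of the Rayleigh quotient on the unit sphere of the subspace is an eigenvector.\<close>

lemma symmetric_eigenvector_in_subspace:
  fixes M :: "real^'n^'n"
  assumes M: "transpose M = M" and T: "subspace T" "T \<noteq> {0}"
    and inv: "\<And>v. v \<in> T \<Longrightarrow> M *v v \<in> T"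
  obtains v where "v \<in> T" "norm v = 1" "M *v v = (v \<bullet> (M *v v)) *\<^sub>R v"
proof -
  let ?K = "sphere 0 1 \<inter> T"
  obtain u where u: "u \<in> T" "u \<noteq> 0"
    using T subspace_0 by blast
  have "(1 / norm u) *\<^sub>R u \<in> ?K"
    using u T(1) by (simp add: subspace_scale)
  then have ne: "?K \<noteq> {}" by blast
  have cpt: "compact ?K"
    using T(1) by (simp add: closed_subspace compact_Int_closed)
  have cont: "continuous_on ?K (\<lambda>v. v \<bullet> (M *v v))"
    by (intro continuous_intros linear_continuous_on matrix_vector_mul_bounded_linear)
  obtain v where v: "v \<in> ?K" and max: "\<And>w. w \<in> ?K \<Longrightarrow> w \<bullet> (M *v w) \<le> v \<bullet> (M *v v)"
    using continuous_attains_sup[OF cpt ne cont] by blast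
  define c where "c = v \<bullet> (M *v v)"
  have vT: "v \<in> T" and nv: "norm v = 1" using v by auto
  have bound: "w \<bullet> (M *v w) \<le> c * (w \<bullet> w)" if "w \<in> T" for w
  proof (cases "w = 0")
    case False
    have "(1 / norm w) *\<^sub>R w \<in> ?K"
      using False that T(1) by (simp add: subspace_scale)
    from max[OF this] have "(w \<bullet> (M *v w)) / (norm w)\<^sup>2 \<le> c"
      by (simp add: c_def matrix_vector_mult_scaleR power2_eq_square)
    then show ?thesis
      using False by (simp add: divide_simps dot_square_norm)
  qed simp
  define r where "r = c *\<^sub>R v - M *v v"
  define Q where "Q = c * (r \<bullet> r) - r \<bullet> (M *v r)"
  have rT: "r \<in> T"
    unfolding r_def using vT inv T(1) by (simp add: subspace_diff subspace_scale)
  have vv: "v \<bullet> v = 1" using nv by (simp add: norm_eq_1)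
  have vr: "v \<bullet> r = 0" by (simp add: r_def inner_diff_right vv c_def)
  have vMr: "v \<bullet> (M *v r) = - (r \<bullet> r)"
  proof -
    have "v \<bullet> (M *v r) = (M *v v) \<bullet> r"
      using symmetric_matrix_inner[OF M] by simp
    also have "\<dots> = (c *\<^sub>R v - r) \<bullet> r" by (simp add: r_def)
    finally show ?thesis by (simp add: inner_diff_left vr)
  qed
  have rMv: "r \<bullet> (M *v v) = - (r \<bullet> r)"
    using vMr symmetric_matrix_inner[OF M, of v r] by (simp add: inner_commute)
  have Q0: "0 \<le> Q" using bound[OF rT] by (simp add: Q_def)
  \<comment> \<open>The Rayleigh bound at \<open>v - e *\<^sub>R r\<close>, after cancellation of
    the constant terms. The left side is linear in \<open>e\<close> and the right side quadratic, so
    small positive \<open>e\<close> force \<open>r = 0\<close>.\<close>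
  have ineq: "2 * e * (r \<bullet> r) \<le> e\<^sup>2 * Q" for e
  proof -
    have "v - e *\<^sub>R r \<in> T"
      using vT rT T(1) by (simp add: subspace_diff subspace_scale)
    from bound[OF this] show ?thesis
      using vr vv vMr rMv
      by (simp add: matrix_vector_mult_diff_distrib matrix_vector_mult_scaleR inner_diff
          Q_def c_def[symmetric] inner_commute[of r v] power2_eq_square algebra_simps)
  qed
  have "r \<bullet> r \<le> 0"
  proof (rule ccontr)
    assume "\<not> r \<bullet> r \<le> 0"
    then have R: "0 < r \<bullet> r" by (simp only: not_le)
    \<comment> \<open>Small enough that the linear term wins; the \<open>+ 1\<close> keeps the
      denominator positive when \<open>Q = 0\<close>.\<close>
    define e where "e = (r \<bullet> r) / (Q + 1)"
    have e: "0 < e" "e * (Q + 1) = r \<bullet> r" using R Q0 by (auto simp: e_def)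
    have "2 * (r \<bullet> r) \<le> e * Q"
      using ineq[of e] e(1) by (simp add: power2_eq_square)
    then show False using e R by (simp add: algebra_simps)
  qed
  then have "r = 0" by (metis inner_ge_zero inner_eq_zero_iff antisym)
  then show thesis using that vT nv by (simp add: r_def c_def)
qed

text \<open>Each eigenvalue is recovered as the Rayleigh quotient of its basis vector, so a basis is
  a plain set without an accompanying eigenvalue function.\<close>

definition orthonormal_eigenbasis :: "real^'n^'n \<Rightarrow> (real^'n) set \<Rightarrow> bool" where
  "orthonormal_eigenbasis M B \<longleftrightarrow> pairwise orthogonal B \<and> (\<forall>b\<in>B. norm b = 1) \<and> span B = UNIV \<and>
     (\<forall>b\<in>B. M *v b = (b \<bullet> (M *v b)) *\<^sub>R b)"

text \<open>Induction on the dimension: a unit eigenvector \<open>v\<close> is split off, and its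
  orthogonal complement within \<open>T\<close> stays invariant because \<open>M\<close> is
  symmetric.\<close>

lemma symmetric_eigenbasis_of_subspace:
  fixes M :: "real^'n^'n"
  assumes M: "transpose M = M"
  shows "subspace T \<Longrightarrow> (\<And>v. v \<in> T \<Longrightarrow> M *v v \<in> T) \<Longrightarrow>
    \<exists>B. B \<subseteq> T \<and> pairwise orthogonal B \<and> (\<forall>b\<in>B. norm b = 1) \<and> T \<subseteq> span B \<and>
      (\<forall>b\<in>B. M *v b = (b \<bullet> (M *v b)) *\<^sub>R b)"
proof (induction "dim T" arbitrary: T rule: less_induct)
  case less
  show ?case
  proof (cases "T = {0}")
    case True
    then show ?thesis by (intro exI[of _ "{}"]) auto
  next
    case False
    obtain v where v: "v \<in> T" "norm v = 1" and ev: "M *v v = (v \<bullet> (M *v v)) *\<^sub>R v"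
      using symmetric_eigenvector_in_subspace[OF M less.prems(1) False less.prems(2)] by metis
    define T' where "T' = {w \<in> T. v \<bullet> w = 0}"
    have sub: "subspace T'"
      using less.prems(1) unfolding T'_def subspace_def by (auto simp: inner_add_right)
    have "M *v w \<in> T'" if "w \<in> T'" for w
    proof -
      have "v \<bullet> (M *v w) = (M *v v) \<bullet> w" by (simp add: symmetric_matrix_inner[OF M])
      also have "\<dots> = 0" using that by (subst ev) (simp add: T'_def)
      finally show ?thesis using that less.prems(2) by (simp add: T'_def)
    qed
    note stable = this
    have "v \<notin> T'" using v by (auto simp: T'_def)
    moreover have "T' \<subseteq> T" by (auto simp: T'_def)
    ultimately have "T' \<subset> T" using v(1) by blast
    then have "dim T' < dim T"
      by (metis dim_psubset less.prems(1) span_eq_iff sub)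
    then obtain B where B: "B \<subseteq> T'" "pairwise orthogonal B" "\<forall>b\<in>B. norm b = 1" "T' \<subseteq> span B"
        "\<forall>b\<in>B. M *v b = (b \<bullet> (M *v b)) *\<^sub>R b"
      using less.hyps[of T'] sub stable by blast
    have "w \<in> span (insert v B)" if "w \<in> T" for w
    proof -
      have "w - (v \<bullet> w) *\<^sub>R v \<in> T'"
        using that v less.prems(1)
        by (simp add: T'_def subspace_diff subspace_scale inner_diff_right norm_eq_1)
      then show ?thesis using B(4) by (auto simp: span_insert)
    qed
    moreover have "pairwise orthogonal (insert v B)"
      using B(1,2) by (auto simp: pairwise_insert T'_def orthogonal_def inner_commute)
    ultimately show ?thesis
      using B v ev by (intro exI[of _ "insert v B"]) (auto simp: T'_def)
  qed
qed

lemma orthonormal_eigenbasis_exists: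
  fixes M :: "real^'n^'n"
  assumes "transpose M = M"
  obtains B where "orthonormal_eigenbasis M B"
  using symmetric_eigenbasis_of_subspace[OF assms, of UNIV] unfolding orthonormal_eigenbasis_def
  by (auto simp: top.extremum_unique)

text \<open>Over an eigenbasis this is the functional calculus of \<open>M\<close>, except that
  \<phi> takes basis vectors instead of eigenvalues, which spares any bookkeeping of
  multiplicities.\<close>

definition spectral_mat :: "(real^'n) set \<Rightarrow> (real^'n \<Rightarrow> real) \<Rightarrow> real^'n^'n" where
  "spectral_mat B \<phi> = (\<chi> i j. \<Sum>b\<in>B. \<phi> b * b $ i * b $ j)"

lemma transpose_spectral_mat: "transpose (spectral_mat B \<phi>) = spectral_mat B \<phi>"
  by (simp add: spectral_mat_def transpose_def vec_eq_iff mult_ac)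

lemma spectral_mat_mult_vec: "spectral_mat B \<phi> *v v = (\<Sum>b\<in>B. (\<phi> b * (b \<bullet> v)) *\<^sub>R b)"
  unfolding vec_eq_iff
  by (auto simp: spectral_mat_def matrix_vector_mult_def inner_vec_def sum_distrib_left
      sum_distrib_right sum.swap[of _ B] intro!: sum.cong)

context
  fixes M :: "real^'n^'n" and B
  assumes B: "orthonormal_eigenbasis M B"
begin

lemma eigenbasis_finite: "finite B"
  using B unfolding orthonormal_eigenbasis_def by (simp add: pairwise_orthogonal_imp_finite)

lemma eigenbasis_inner: "b \<in> B \<Longrightarrow> b' \<in> B \<Longrightarrow> b \<bullet> b' = (if b = b' then 1 else 0)"
  using B unfolding orthonormal_eigenbasis_def pairwise_def orthogonal_def by (auto simp: norm_eq_1)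

lemma eigenbasis_expand: "(\<Sum>b\<in>B. (b \<bullet> v) *\<^sub>R b) = v"
  using B orthonormal_basis_expand[of B v] eigenbasis_finite
  unfolding orthonormal_eigenbasis_def by (simp add: inner_commute)

lemma eigenbasis_inner_expand: "v \<bullet> w = (\<Sum>b\<in>B. (b \<bullet> v) * (b \<bullet> w))"
  by (subst eigenbasis_expand[of v, symmetric]) (simp add: inner_sum_left)

text \<open>Orthonormality removes the cross terms. Square roots and pseudoinverses thereby reduce
  to identities between real coefficients.\<close>

lemma spectral_mat_mult:
  "spectral_mat B \<phi> ** spectral_mat B \<psi> = spectral_mat B (\<lambda>b. \<phi> b * \<psi> b)"
proof -
  have "spectral_mat B \<phi> *v (spectral_mat B \<psi> *v v) = spectral_mat B (\<lambda>b. \<phi> b * \<psi> b) *v v" for v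
    unfolding spectral_mat_mult_vec
    by (intro sum.cong refl)
      (simp add: inner_sum_right eigenbasis_inner eigenbasis_finite if_distrib sum.delta cong: if_cong)
  then show ?thesis
    by (simp add: matrix_eq matrix_vector_mul_assoc)
qed

lemma spectral_mat_eigenvalues: "spectral_mat B (\<lambda>b. b \<bullet> (M *v b)) = M"
proof -
  have "M *v v = spectral_mat B (\<lambda>b. b \<bullet> (M *v b)) *v v" for v
  proof -
    have "M *v v = (\<Sum>b\<in>B. (b \<bullet> v) *\<^sub>R (M *v b))"
      by (subst eigenbasis_expand[of v, symmetric])
        (simp add: vec.linear_sum[OF matrix_vector_mul_linear_gen] scalar_mult_eq_scaleR matrix_vector_mult_scaleR)
    also have "\<dots> = spectral_mat B (\<lambda>b. b \<bullet> (M *v b)) *v v"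
      unfolding spectral_mat_mult_vec
      using B by (intro sum.cong refl) (metis orthonormal_eigenbasis_def scaleR_scaleR mult.commute)
    finally show ?thesis .
  qed
  then show ?thesis by (metis matrix_eq)
qed

lemma spectral_mat_quadratic: "v \<bullet> (spectral_mat B \<phi> *v v) = (\<Sum>b\<in>B. \<phi> b * (b \<bullet> v)\<^sup>2)"
  by (simp add: spectral_mat_mult_vec inner_sum_right power2_eq_square inner_commute[of v] mult.assoc)

end

section \<open>The Moore-Penrose pseudoinverse of a symmetric matrix\<close>

definition penrose_inverse :: "real^'n^'m \<Rightarrow> real^'m^'n \<Rightarrow> bool" where
  "penrose_inverse M B \<longleftrightarrow> M ** B ** M = M \<and> B ** M ** B = B \<and>
     transpose (M ** B) = M ** B \<and> transpose (B ** M) = B ** M"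

text \<open>Transposing shows that both candidates give the same projections \<open>M ** B\<close>
  and \<open>B ** M\<close>; then \<open>B = B ** M ** B\<close> can be rewritten factor by factor
  into \<open>C\<close>.\<close>

lemma penrose_inverse_unique:
  assumes B: "penrose_inverse M B" and C: "penrose_inverse M C"
  shows "B = C"
proof -
  have "M ** B = M ** C"
  proof -
    have "M ** C = transpose (M ** B ** M ** C)"
      using B C by (simp add: penrose_inverse_def)
    also have "\<dots> = transpose (M ** C) ** transpose (M ** B)"
      by (metis matrix_mul_assoc matrix_transpose_mul)
    also have "\<dots> = M ** C ** M ** B"
      using B C by (simp add: penrose_inverse_def matrix_mul_assoc)
    finally show ?thesis using C by (simp add: penrose_inverse_def)
  qed
  moreover have "B ** M = C ** M"
  proof -
    have "C ** M = transpose (C ** M ** B ** M)"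
      using B C unfolding penrose_inverse_def by (metis matrix_mul_assoc)
    also have "\<dots> = transpose (B ** M) ** transpose (C ** M)"
      by (metis matrix_mul_assoc matrix_transpose_mul)
    also have "\<dots> = B ** (M ** C ** M)"
      using B C by (metis penrose_inverse_def matrix_mul_assoc)
    finally show ?thesis using C unfolding penrose_inverse_def by metis
  qed
  ultimately show ?thesis
    using B C unfolding penrose_inverse_def by (metis matrix_mul_assoc)
qed

text \<open>Eigenvalues are inverted one by one, and the convention \<open>inverse 0 = 0\<close>
  gives the right value on the null space. With uniqueness, the description in \<open>pinv\<close>
  is well defined.\<close>

lemma penrose_inverse_pinv:
  fixes M :: "real^'n^'n"
  assumes "transpose M = M"
  shows "penrose_inverse M (pinv M)"
proof -
  obtain B where B: "orthonormal_eigenbasis M B"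
    using orthonormal_eigenbasis_exists[OF assms] .
  let ?c = "\<lambda>b. b \<bullet> (M *v b)"
  have "a * inverse a * a = a" "inverse a * a * inverse a = inverse a" for a :: real
    by (cases "a = 0"; simp)+
  then have "penrose_inverse (spectral_mat B ?c) (spectral_mat B (\<lambda>b. inverse (?c b)))"
    unfolding penrose_inverse_def
    by (auto simp: spectral_mat_mult[OF B] transpose_spectral_mat intro!: arg_cong[of _ _ "spectral_mat B"])
  then have "penrose_inverse M (spectral_mat B (\<lambda>b. inverse (?c b)))"
    by (simp add: spectral_mat_eigenvalues[OF B])
  then have "\<exists>!C. penrose_inverse M C"
    using penrose_inverse_unique by blast
  from theI'[OF this] show ?thesis
    unfolding pinv_def penrose_inverse_def .
qed

section \<open>The positive semidefinite square root\<close>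

lemma symmetric_square_null:
  fixes S :: "real^'n^'n"
  assumes "transpose S = S" and "S *v (S *v v) = 0"
  shows "S *v v = 0"
  using assms symmetric_matrix_inner[of S v "S *v v"] by (metis inner_eq_zero_iff inner_zero_right)

text \<open>It suffices to compare both roots on an eigenbasis of \<open>S\<close>, where the square
  of \<open>T\<close> acts on \<open>b\<close> as the scalar \<open>s * s\<close>.\<close>

lemma sym_psd_sqrt_unique:
  fixes S T :: "real^'n^'n"
  assumes S: "sym_psd S" and T: "sym_psd T" and eq: "S ** S = T ** T"
  shows "S = T"
proof -
  have symS: "transpose S = S" and symT: "transpose T = T"
    using S T by (auto simp: sym_psd_def)
  obtain B where B: "orthonormal_eigenbasis S B"
    using orthonormal_eigenbasis_exists[OF symS] .
  have agree: "T *v b = S *v b" if b: "b \<in> B" for b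
  proof -
    define s where "s = b \<bullet> (S *v b)"
    have s: "0 \<le> s" using S by (simp add: s_def sym_psd_def)
    have Sb: "S *v b = s *\<^sub>R b"
      using B b unfolding s_def orthonormal_eigenbasis_def by blast
    have TT: "T *v (T *v b) = (s * s) *\<^sub>R b"
    proof -
      have "T *v (T *v b) = S *v (S *v b)"
        by (simp add: matrix_vector_mul_assoc eq)
      then show ?thesis by (simp add: Sb matrix_vector_mult_scaleR)
    qed
    show ?thesis
    proof (cases "s = 0")
      case True
      then show ?thesis using TT symmetric_square_null[OF symT, of b] Sb by simp
    next
      case False
      \<comment> \<open>Factoring the difference of squares gives (T + s)(T - s) b = 0, so
        \<open>T\<close> acts on \<open>u\<close> as the negative scalar \<open>- s\<close>.
        Positive semidefiniteness then leaves only \<open>u = 0\<close>.\<close>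
      define u where "u = T *v b - s *\<^sub>R b"
      have "T *v u = - s *\<^sub>R u"
        by (simp add: u_def matrix_vector_mult_diff_distrib matrix_vector_mult_scaleR TT algebra_simps)
      then have "u \<bullet> (T *v u) = - s * (u \<bullet> u)" by simp
      moreover have "0 \<le> u \<bullet> (T *v u)" using T by (simp add: sym_psd_def)
      ultimately have "u \<bullet> u \<le> 0"
        using False s by (simp add: mult_le_0_iff zero_le_mult_iff)
      then have "u = 0" by (metis inner_ge_zero inner_eq_zero_iff antisym)
      then show ?thesis by (simp add: u_def Sb)
    qed
  qed
  have "T *v v = S *v v" for v
    by (subst (1 2) eigenbasis_expand[OF B, of v, symmetric])
      (simp add: vec.linear_sum[OF matrix_vector_mul_linear_gen] matrix_vector_mult_scaleR agree cong: sum.cong)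
  then show ?thesis unfolding matrix_eq by simp
qed

lemma psd_sqrt:
  fixes M :: "real^'n^'n"
  assumes M: "sym_psd M"
  shows "sym_psd (psd_sqrt M)" and "psd_sqrt M ** psd_sqrt M = M"
proof -
  have symM: "transpose M = M" and pos: "\<And>v. 0 \<le> v \<bullet> (M *v v)"
    using M by (auto simp: sym_psd_def)
  obtain B where B: "orthonormal_eigenbasis M B"
    using orthonormal_eigenbasis_exists[OF symM] .
  let ?S = "spectral_mat B (\<lambda>b. sqrt (b \<bullet> (M *v b)))"
  have "sym_psd ?S"
    unfolding sym_psd_def
    by (auto simp: transpose_spectral_mat spectral_mat_quadratic[OF B] pos intro!: sum_nonneg)
  moreover have "?S ** ?S = M"
    using spectral_mat_eigenvalues[OF B] by (simp add: spectral_mat_mult[OF B] pos)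
  ultimately have "\<exists>!S. sym_psd S \<and> S ** S = M"
    using sym_psd_sqrt_unique by metis
  from theI'[OF this] show "sym_psd (psd_sqrt M)" "psd_sqrt M ** psd_sqrt M = M"
    unfolding psd_sqrt_def by auto
qed

section \<open>The largest eigenvalue\<close>

lemma eigenvalue_le_max_eigenvalue:
  fixes M :: "real^'n^'n"
  assumes M: "transpose M = M" and v: "v \<noteq> 0" "M *v v = c *\<^sub>R v"
  shows "c \<le> max_eigenvalue M"
proof -
  obtain B where B: "orthonormal_eigenbasis M B"
    using orthonormal_eigenbasis_exists[OF M] .
  \<comment> \<open>\<open>Max\<close> is meaningful only on a finite set. An eigenvector has a
    nonzero coefficient along some \<open>b\<close>, and moving \<open>M\<close> across the inner
    product equates the two eigenvalues.\<close>
  have "c \<in> (\<lambda>b. b \<bullet> (M *v b)) ` B" if v: "v \<noteq> 0" "M *v v = c *\<^sub>R v" for v c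
  proof -
    obtain b where b: "b \<in> B" "b \<bullet> v \<noteq> 0"
      using v eigenbasis_expand[OF B, of v] by (metis (no_types, lifting) scaleR_zero_left sum.neutral)
    have Mb: "M *v b = (b \<bullet> (M *v b)) *\<^sub>R b"
      using B b unfolding orthonormal_eigenbasis_def by blast
    have "c * (b \<bullet> v) = (M *v b) \<bullet> v"
      using v by (simp add: symmetric_matrix_inner[OF M])
    also have "\<dots> = (b \<bullet> (M *v b)) * (b \<bullet> v)"
      by (subst Mb) simp
    finally show ?thesis using b by auto
  qed
  then have "{c. \<exists>v. v \<noteq> 0 \<and> M *v v = c *\<^sub>R v} \<subseteq> (\<lambda>b. b \<bullet> (M *v b)) ` B" by blast
  then have "finite {c. \<exists>v. v \<noteq> 0 \<and> M *v v = c *\<^sub>R v}"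
    using eigenbasis_finite[OF B] finite_subset by blast
  then show ?thesis
    unfolding max_eigenvalue_def using v by (intro Max_ge) auto
qed

text \<open>The two upper bounds hold coefficientwise in an eigenbasis; the second uses that the
  square of a nonnegative eigenvalue is at most the largest eigenvalue times it.\<close>

lemma
  fixes M :: "real^'n^'n"
  assumes M: "sym_psd M"
  shows quadratic_le_max_eigenvalue: "v \<bullet> (M *v v) \<le> max_eigenvalue M * (v \<bullet> v)"
    and norm_mult_le_max_eigenvalue: "(norm (M *v v))\<^sup>2 \<le> max_eigenvalue M * (v \<bullet> (M *v v))"
    and max_eigenvalue_nonneg: "0 \<le> max_eigenvalue M"
proof -
  have symM: "transpose M = M" and pos: "\<And>v. 0 \<le> v \<bullet> (M *v v)"
    using M by (auto simp: sym_psd_def)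
  obtain B where B: "orthonormal_eigenbasis M B"
    using orthonormal_eigenbasis_exists[OF symM] .
  let ?c = "\<lambda>b. b \<bullet> (M *v b)"
  note M_spec = spectral_mat_eigenvalues[OF B]
  have c: "?c b \<le> max_eigenvalue M" if "b \<in> B" for b
  proof (rule eigenvalue_le_max_eigenvalue[OF symM])
    show "b \<noteq> 0" using B that unfolding orthonormal_eigenbasis_def by force
    show "M *v b = ?c b *\<^sub>R b" using B that unfolding orthonormal_eigenbasis_def by blast
  qed
  have quad: "v \<bullet> (M *v v) = (\<Sum>b\<in>B. ?c b * (b \<bullet> v)\<^sup>2)"
    by (metis spectral_mat_quadratic[OF B] M_spec)
  show "v \<bullet> (M *v v) \<le> max_eigenvalue M * (v \<bullet> v)"
    unfolding quad eigenbasis_inner_expand[OF B, of v v] sum_distrib_left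
    by (intro sum_mono) (simp add: c mult_right_mono flip: power2_eq_square)
  have "(norm (M *v v))\<^sup>2 = v \<bullet> ((M ** M) *v v)"
    by (simp add: dot_square_norm[symmetric] symmetric_matrix_inner[OF symM] matrix_vector_mul_assoc)
  also have "\<dots> = (\<Sum>b\<in>B. (?c b * ?c b) * (b \<bullet> v)\<^sup>2)"
    by (metis spectral_mat_quadratic[OF B] spectral_mat_mult[OF B] M_spec)
  also have "\<dots> \<le> (\<Sum>b\<in>B. max_eigenvalue M * (?c b * (b \<bullet> v)\<^sup>2))"
    by (intro sum_mono) (simp add: c pos mult_right_mono mult.assoc)
  also have "\<dots> = max_eigenvalue M * (v \<bullet> (M *v v))"
    by (simp add: quad sum_distrib_left)
  finally show "(norm (M *v v))\<^sup>2 \<le> max_eigenvalue M * (v \<bullet> (M *v v))" .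
  obtain b where "b \<in> B"
    using eigenbasis_expand[OF B, of 1] by fastforce
  then show "0 \<le> max_eigenvalue M" using c pos order_trans by blast
qed

section \<open>Stacked vectors and lifted matrices\<close>

text \<open>Stacked vectors are cut along one coordinate across all agents, because
  \<open>lift_mat P\<close> acts on each such slice as \<open>P\<close> itself.\<close>

definition slice :: "'q::finite \<Rightarrow> real^('n::finite \<times> 'q) \<Rightarrow> real^'n" where
  "slice q v = (\<chi> i. v $ (i, q))"

definition block_sum :: "real^('n::finite \<times> 'q::finite) \<Rightarrow> real^'q" where
  "block_sum v = (\<chi> q. \<Sum>i\<in>UNIV. v $ (i, q))"

text \<open>The adjoint of \<open>block_sum\<close>. Its range is the null space of the lifted
  \<open>P\<^sub>H\<close>.\<close>

definition consensus :: "real^'q::finite \<Rightarrow> real^('n::finite \<times> 'q)" where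
  "consensus u = (\<chi> r. u $ snd r)"

lemma sum_UNIV_prod: "(\<Sum>r\<in>UNIV. F r) = (\<Sum>q\<in>UNIV. \<Sum>i\<in>UNIV. F (i :: 'n::finite, q :: 'q::finite))"
proof -
  have "(\<Sum>r\<in>UNIV. F r) = (\<Sum>i\<in>UNIV. \<Sum>q\<in>UNIV. F (i, q))"
    by (simp add: sum.cartesian_product flip: UNIV_Times_UNIV)
  also have "\<dots> = (\<Sum>q\<in>UNIV. \<Sum>i\<in>UNIV. F (i, q))"
    by (rule sum.swap)
  finally show ?thesis .
qed

lemma inner_slices:
  fixes v w :: "real^('n::finite \<times> 'q::finite)"
  shows "v \<bullet> w = (\<Sum>q\<in>UNIV. slice q v \<bullet> slice q w)"
  by (simp add: inner_vec_def sum_UNIV_prod slice_def)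

lemma slice_lift_mat: "slice q (lift_mat P *v v) = P *v slice q v"
proof -
  have "(lift_mat P *v v) $ (i, q) = (\<Sum>j\<in>UNIV. \<Sum>q'\<in>UNIV. if q = q' then P $ i $ j * v $ (j, q') else 0)" for i
    unfolding lift_mat_def kron_def matrix_vector_mult_def mat_def
    by (subst sum.swap) (auto simp: sum_UNIV_prod intro!: sum.cong)
  then show ?thesis
    by (simp add: vec_eq_iff slice_def matrix_vector_mult_def)
qed

lemma slice_consensus: "slice q (consensus u) = u $ q *\<^sub>R 1"
  by (simp add: slice_def consensus_def vec_eq_iff)

lemma block_sum_nth: "block_sum v $ q = 1 \<bullet> slice q v"
  by (simp add: block_sum_def slice_def inner_vec_def)

lemma block_sum_linear:
  "block_sum 0 = 0"
  "block_sum (v + w) = block_sum v + block_sum w"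
  "block_sum (v - w) = block_sum v - block_sum w"
  "block_sum (c *\<^sub>R v) = c *\<^sub>R block_sum v"
  by (simp_all add: block_sum_def vec_eq_iff sum.distrib sum_subtractf sum_distrib_left)

lemma block_sum_consensus:
  "block_sum (consensus u :: real^('n::finite \<times> 'q::finite)) = real CARD('n) *\<^sub>R u"
  by (simp add: block_sum_def consensus_def vec_eq_iff)

lemma inner_consensus:
  fixes v :: "real^('n::finite \<times> 'q::finite)"
  shows "consensus u \<bullet> v = u \<bullet> block_sum v"
  by (simp add: inner_vec_def consensus_def block_sum_def sum_UNIV_prod sum_distrib_left)

lemma lift_mat_quadratic:
  "v \<bullet> (lift_mat P *v v) = (\<Sum>q\<in>UNIV. slice q v \<bullet> (P *v slice q v))"
  by (simp add: inner_slices slice_lift_mat)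

lemma lift_mat_add_scaleR: "lift_mat (P + c *\<^sub>R Q) = lift_mat P + c *\<^sub>R lift_mat Q"
  by (simp add: lift_mat_def kron_def vec_eq_iff algebra_simps)

lemma lift_mat_diff: "lift_mat (P - Q) = lift_mat P - lift_mat Q"
  by (simp add: lift_mat_def kron_def vec_eq_iff algebra_simps)

lemma sym_psd_lift_mat:
  assumes "sym_psd P"
  shows "sym_psd (lift_mat P)"
proof -
  have "P $ i $ j = P $ j $ i" for i j
    using assms unfolding sym_psd_def by (metis transpose_def vec_lambda_beta)
  then have "transpose (lift_mat P) = lift_mat P"
    by (auto simp: vec_eq_iff transpose_def lift_mat_def kron_def mat_def)
  then show ?thesis
    using assms by (simp add: sym_psd_def lift_mat_quadratic sum_nonneg)
qed

lemma lift_mat_null_iff_consensus: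
  fixes v :: "real^('n::finite \<times> 'q::finite)"
  assumes "null_sp P = span {1}"
  shows "lift_mat P *v v = 0 \<longleftrightarrow> (\<exists>u. v = consensus u)"
proof -
  have null: "P *v w = 0 \<longleftrightarrow> (\<exists>c. w = c *\<^sub>R 1)" for w
    using assms by (auto simp: null_sp_def span_singleton set_eq_iff image_iff)
  have "lift_mat P *v v = 0 \<longleftrightarrow> (\<forall>q. P *v slice q v = 0)"
    by (simp flip: slice_lift_mat) (auto simp: vec_eq_iff slice_def)
  also have "\<dots> \<longleftrightarrow> (\<forall>q. \<exists>c. slice q v = c *\<^sub>R 1)"
    by (simp add: null)
  also have "\<dots> \<longleftrightarrow> (\<exists>u. \<forall>q. slice q v = u $ q *\<^sub>R 1)"
    by (metis vec_lambda_beta)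
  also have "\<dots> \<longleftrightarrow> (\<exists>u. v = consensus u)"
    by (auto simp: vec_eq_iff slice_def consensus_def)
  finally show ?thesis .
qed

lemma inner_one_vec: "(1 :: real^'n) \<bullet> 1 = real CARD('n)"
  by (simp add: inner_vec_def)

text \<open>Source of the leading constant of the bound: Cauchy-Schwarz against the all-ones vector
  contributes \<open>CARD('n)\<close> on each slice, and \<open>norm_mult_le_max_eigenvalue\<close>
  contributes the eigenvalue.\<close>

lemma norm_block_sum_lift_mat_le:
  fixes P :: "real^'n^'n" and v :: "real^('n \<times> 'q::finite)"
  assumes P: "sym_psd P"
  shows "norm (block_sum (lift_mat P *v v)) \<le> sqrt (real CARD('n) * max_eigenvalue P) * wnorm (lift_mat P) v"
proof -
  have "(norm (block_sum (lift_mat P *v v)))\<^sup>2 = (\<Sum>q\<in>UNIV. (1 \<bullet> (P *v slice q v))\<^sup>2)"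
    unfolding power2_norm_eq_inner inner_vec_def[of "block_sum _"]
    by (simp add: block_sum_nth slice_lift_mat power2_eq_square)
  also have "\<dots> \<le> (\<Sum>q\<in>UNIV. real CARD('n) * (max_eigenvalue P * (slice q v \<bullet> (P *v slice q v))))"
  proof (rule sum_mono)
    fix q
    let ?w = "P *v slice q v"
    have "(1 \<bullet> ?w)\<^sup>2 \<le> ((1 :: real^'n) \<bullet> 1) * (?w \<bullet> ?w)"
      by (rule Cauchy_Schwarz_ineq)
    also have "\<dots> \<le> real CARD('n) * (max_eigenvalue P * (slice q v \<bullet> ?w))"
      unfolding inner_one_vec using norm_mult_le_max_eigenvalue[OF P]
      by (intro mult_left_mono) (auto simp: power2_norm_eq_inner)
    finally show "(1 \<bullet> ?w)\<^sup>2 \<le> real CARD('n) * (max_eigenvalue P * (slice q v \<bullet> ?w))" .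
  qed
  also have "\<dots> = real CARD('n) * max_eigenvalue P * (v \<bullet> (lift_mat P *v v))"
    by (simp add: lift_mat_quadratic sum_distrib_left mult.assoc)
  finally show ?thesis
    unfolding wnorm_def by (metis real_le_rsqrt real_sqrt_mult)
qed

lemma wnorm_lift_mat_consensus_le:
  fixes P :: "real^'n^'n" and u :: "real^'q::finite"
  assumes P: "sym_psd P"
  shows "wnorm (lift_mat P) (consensus u) \<le> sqrt (real CARD('n) * max_eigenvalue P) * norm u"
proof -
  have "consensus u \<bullet> (lift_mat P *v consensus u) = (\<Sum>q\<in>UNIV. (u $ q)\<^sup>2 * (1 \<bullet> (P *v 1)))"
    by (simp add: lift_mat_quadratic slice_consensus matrix_vector_mult_scaleR power2_eq_square mult.assoc)
  also have "\<dots> \<le> (\<Sum>q\<in>UNIV. (u $ q)\<^sup>2 * (max_eigenvalue P * real CARD('n)))"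
    using quadratic_le_max_eigenvalue[OF P, of 1] by (intro sum_mono mult_left_mono) (auto simp: inner_one_vec)
  also have "\<dots> = real CARD('n) * max_eigenvalue P * (norm u)\<^sup>2"
    unfolding power2_norm_eq_inner inner_vec_def
    by (simp add: sum_distrib_left power2_eq_square mult_ac)
  finally show ?thesis
    unfolding wnorm_def
    by (metis real_sqrt_le_mono real_sqrt_mult real_sqrt_abs abs_norm_cancel)
qed

text \<open>Writes the seminorm as a Euclidean norm, from which it inherits the triangle
  inequality.\<close>

lemma wnorm_eq_norm_psd_sqrt:
  assumes "sym_psd M"
  shows "wnorm M v = norm (psd_sqrt M *v v)"
proof -
  have "v \<bullet> (M *v v) = (psd_sqrt M *v v) \<bullet> (psd_sqrt M *v v)"
    using psd_sqrt[OF assms] by (simp add: sym_psd_def symmetric_matrix_inner matrix_vector_mul_assoc)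
  then show ?thesis by (simp add: wnorm_def norm_eq_sqrt_inner)
qed

lemma wnorm_diff_le:
  "sym_psd M \<Longrightarrow> wnorm M (u - v) \<le> wnorm M u + wnorm M v"
  by (simp add: wnorm_eq_norm_psd_sqrt matrix_vector_mult_diff_distrib norm_triangle_ineq4)

lemma wnorm_power2: "sym_psd M \<Longrightarrow> (wnorm M v)\<^sup>2 = v \<bullet> (M *v v)"
  by (simp add: wnorm_def sym_psd_def)

lemma lift_mat_diag_nth:
  assumes "diag_mat P"
  shows "(lift_mat P *v v) $ r = P $ fst r $ fst r * v $ r"
proof -
  have "(lift_mat P *v v) $ r = (P *v slice (snd r) v) $ fst r"
    unfolding slice_lift_mat[symmetric] by (simp add: slice_def)
  also have "\<dots> = (\<Sum>j\<in>UNIV. if j = fst r then P $ fst r $ j * v $ (j, snd r) else 0)"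
    unfolding matrix_vector_mult_def vec_lambda_beta using assms
    by (intro sum.cong) (auto simp: slice_def diag_mat_def)
  finally show ?thesis by simp
qed

lemma sym_pd_diag_pos:
  fixes P :: "real^'n^'n"
  assumes "sym_pd P"
  shows "0 < P $ i $ i"
proof -
  have "axis i 1 \<bullet> (P *v axis i 1) = P $ i $ i"
    by (simp add: inner_axis' inner_axis matrix_vector_mul_component column_def)
  moreover have "axis i (1::real) \<noteq> 0" by simp
  ultimately show ?thesis using assms unfolding sym_pd_def by metis
qed

lemma matrix_inv_lift_mat_diag_nth:
  fixes P :: "real^'n^'n" and v :: "real^('n \<times> 'q::finite)"
  assumes P: "sym_pd P" "diag_mat P"
  shows "(matrix_inv (lift_mat P) *v v) $ r = v $ r / P $ fst r $ fst r"
proof -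
  let ?D = "lift_mat P :: real^('n \<times> 'q)^('n \<times> 'q)"
  note pos = sym_pd_diag_pos[OF P(1)]
  \<comment> \<open>\<open>matrix_inv\<close> is defined by choice, so invertibility has to come
    first; positive diagonal entries leave a trivial kernel.\<close>
  have "u = 0" if "?D *v u = 0" for u
    using that pos by (simp add: vec_eq_iff[of _ 0] lift_mat_diag_nth[OF P(2)] less_imp_neq[THEN not_sym])
  then have "invertible ?D"
    by (metis invertible_left_inverse matrix_left_invertible_ker)
  then have "?D ** matrix_inv ?D = mat 1"
    unfolding invertible_def matrix_inv_def by (rule someI2_ex) simp
  then have "?D *v (matrix_inv ?D *v v) = v"
    by (simp add: matrix_vector_mul_assoc)
  then have "P $ fst r $ fst r * (matrix_inv ?D *v v) $ r = v $ r"
    by (metis lift_mat_diag_nth[OF P(2)])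
  then show ?thesis using pos[of "fst r"] by (simp add: field_simps)
qed

definition pos_mult :: "real^('n::finite \<times> ('m::finite + 'p::finite)) \<Rightarrow> real^('n \<times> ('m + 'p))" where
  "pos_mult w = (\<chi> r. case snd r of Inl a \<Rightarrow> max 0 (w $ r) | Inr b \<Rightarrow> w $ r)"

text \<open>The cone is a product of half-lines and lines, so the distance is minimized in each
  coordinate separately.\<close>

lemma closest_point_dual_cone:
  "closest_point dual_cone w = pos_mult (w :: real^('n::finite \<times> ('m::finite + 'p::finite)))"
proof -
  let ?p = "pos_mult w"
  let ?K = "dual_cone :: (real^('n \<times> ('m + 'p))) set"
  have K: "?K = (\<Inter>i. \<Inter>a. {y. 0 \<le> y $ (i, Inl a)})"
    by (auto simp: dual_cone_def)
  have "closed ?K" unfolding K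
    by (intro closed_INT ballI closed_Collect_le continuous_intros)
  moreover have "convex ?K"
    by (auto simp: convex_def dual_cone_def)
  moreover have p: "?p \<in> ?K" by (simp add: dual_cone_def pos_mult_def)
  moreover have "dist w ?p \<le> dist w u" if "u \<in> ?K" for u
    unfolding dist_norm
  proof (rule norm_le_componentwise_cart)
    fix r :: "'n \<times> ('m + 'p)"
    show "norm ((w - ?p) $ r) \<le> norm ((w - u) $ r)"
    proof (cases r)
      case (Pair i s)
      then show ?thesis
      proof (cases s)
        case (Inl a)
        have "0 \<le> u $ (i, Inl a)" using that by (simp add: dual_cone_def)
        then show ?thesis by (simp add: pos_mult_def Pair Inl max_def)
      qed (simp add: pos_mult_def)
    qed
  qed
  ultimately show ?thesis
    by (metis closest_point_unique)
qed

section \<open>The primal step\<close>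

text \<open>Divide by \<open>t\<close> and let \<open>t\<close> tend to 0. This stands in for
  differentiation along a segment.\<close>

lemma first_order_term_nonneg:
  fixes E F :: real
  assumes "\<And>t. 0 < t \<Longrightarrow> t \<le> 1 \<Longrightarrow> 0 \<le> t * E + t\<^sup>2 * F"
  shows "0 \<le> E"
proof (rule ccontr)
  assume "\<not> 0 \<le> E"
  then have E: "E < 0" by simp
  \<comment> \<open>Small enough that \<open>t * F\<close> is at most half of
    \<open>- E\<close>.\<close>
  define t where "t = min 1 (- E / (2 * (\<bar>F\<bar> + 1)))"
  have t: "0 < t" "t \<le> 1" "t \<le> - E / (2 * (\<bar>F\<bar> + 1))"
    using E by (auto simp: t_def divide_less_0_iff)
  have "t * F \<le> t * (\<bar>F\<bar> + 1)" using t(1) by (intro mult_left_mono) auto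
  also have "\<dots> \<le> - E / 2" using t(3) by (simp add: field_simps)
  finally have "t * (E + t * F) < 0"
    using E t(1) by (intro mult_pos_neg) auto
  then show False using assms[OF t(1,2)] by (simp add: power2_eq_square algebra_simps)
qed

text \<open>A quadratic upper model of the squared positive part around \<open>a\<close>, where its
  derivative is \<open>2 * max 0 a\<close>.\<close>

lemma pos_part_square_le:
  fixes a b :: real
  shows "(max 0 (a + b))\<^sup>2 \<le> (max 0 a)\<^sup>2 + 2 * max 0 a * b + b\<^sup>2"
proof (cases "0 \<le> a")
  case True
  have "(max 0 (a + b))\<^sup>2 \<le> (a + b)\<^sup>2" by (auto simp: max_def)
  then show ?thesis using True by (simp add: power2_eq_square algebra_simps)
next
  case False
  then have "max 0 (a + b) \<le> \<bar>b\<bar>" by auto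
  then have "(max 0 (a + b))\<^sup>2 \<le> \<bar>b\<bar>\<^sup>2" by (intro power_mono) auto
  then show ?thesis using False by simp
qed

lemma affine_map_on_convex_comb:
  assumes F: "affine_map_on S F" and S: "x \<in> S" "y \<in> S" "(1 - t) *\<^sub>R x + t *\<^sub>R y \<in> S"
  shows "F ((1 - t) *\<^sub>R x + t *\<^sub>R y) = (1 - t) *\<^sub>R F x + t *\<^sub>R F y"
proof -
  obtain L c where L: "linear L" "\<And>x. x \<in> S \<Longrightarrow> F x = L x + c"
    using F unfolding affine_map_on_def by blast
  have "F ((1 - t) *\<^sub>R x + t *\<^sub>R y) = (1 - t) *\<^sub>R L x + t *\<^sub>R L y + c"
    by (simp only: L(2)[OF S(3)] linear_add[OF L(1)] linear_scale[OF L(1)])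
  then show ?thesis
    by (simp add: L(2) S algebra_simps)
qed

lemma agent_sum_convex:
  assumes "\<And>i. convex_on (X i) (F i)" and "x \<in> blocks X" "y \<in> blocks X" and "0 \<le> t" "t \<le> 1"
  shows "agent_sum F ((1 - t) *\<^sub>R x + t *\<^sub>R y) \<le> (1 - t) * agent_sum F x + t * agent_sum F y"
  using assms unfolding agent_sum_def blocks_def sum_distrib_left sum.distrib[symmetric]
  by (intro sum_mono) (auto intro: convex_onD)

lemma convex_blocks: "(\<And>i. convex (X i)) \<Longrightarrow> convex (blocks X)"
  unfolding convex_def blocks_def by simp

lemma g_tilde_Inl: "g_tilde g h x $ (i, Inl a) = g i (x $ i) $ a"
  and g_tilde_Inr: "g_tilde g h x $ (i, Inr b) = h i (x $ i) $ b"
  by (simp_all add: g_tilde_def stack_def)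

lemma block_sum_g_tilde: "block_sum (g_tilde g h x) = stack (agent_sum g x) (agent_sum h x)"
  by (auto simp: vec_eq_iff block_sum_def g_tilde_def stack_def agent_sum_def split: sum.split)

lemma inner_stack: "stack u w \<bullet> stack u' w' = u \<bullet> u' + w \<bullet> w'"
  by (simp add: inner_vec_def stack_def sum.Plus flip: UNIV_Plus_UNIV)

text \<open>The minimizer is compared with nearby points on the segment towards \<open>x\<close>.
  The first-order change of the penalty is weighted by \<open>y\<close>, so the penalized problem
  yields an inequality for the Lagrangian with multiplier \<open>y\<close>.\<close>

lemma primal_step_inequality:
  fixes X :: "'n::finite \<Rightarrow> (real^'d::finite) set"
    and g :: "'n \<Rightarrow> real^'d \<Rightarrow> real^'m::finite" and h :: "'n \<Rightarrow> real^'d \<Rightarrow> real^'p::finite"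
    and P :: "real^'n^'n" and c :: "real^('n \<times> ('m + 'p))"
  assumes X: "\<And>i. convex (X i)" and f: "\<And>i. convex_on (X i) (f i)"
    and g: "\<And>i a. convex_on (X i) (\<lambda>v. g i v $ a)" and h: "\<And>i. affine_map_on (X i) (h i)"
    and P: "sym_pd P" "diag_mat P"
    and min: "is_arg_min
      (\<lambda>u. agent_sum f u
        + 1/2 * (wnorm (matrix_inv (lift_mat P)) (closest_point dual_cone (c + g_tilde g h u)))\<^sup>2
        + \<alpha>/2 * (norm (u - x\<^sub>0))\<^sup>2) (\<lambda>u. u \<in> blocks X) x\<^sub>1"
    and y: "y = closest_point dual_cone (matrix_inv (lift_mat P) *v (c + g_tilde g h x\<^sub>1))"
    and x: "x \<in> blocks X"
  shows "agent_sum f x\<^sub>1 + y \<bullet> g_tilde g h x\<^sub>1 + \<alpha> * ((x\<^sub>1 - x\<^sub>0) \<bullet> (x\<^sub>1 - x))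
    \<le> agent_sum f x + y \<bullet> g_tilde g h x"
proof -
  let ?G = "g_tilde g h"
  define d where "d r = P $ fst r $ fst r" for r :: "'n \<times> ('m + 'p)"
  define w where "w = c + ?G x\<^sub>1"
  define \<delta> where "\<delta> = ?G x - ?G x\<^sub>1"
  have d: "0 < d r" for r using sym_pd_diag_pos[OF P(1)] by (simp add: d_def)
  have inv: "(matrix_inv (lift_mat P) *v v) $ r = v $ r / d r" for v :: "real^('n \<times> ('m + 'p))" and r
    by (simp add: d_def matrix_inv_lift_mat_diag_nth[OF P])
  have wn: "(wnorm (matrix_inv (lift_mat P)) v)\<^sup>2 = (\<Sum>r\<in>UNIV. (v $ r)\<^sup>2 / d r)"
    for v :: "real^('n \<times> ('m + 'p))"
  proof -
    have "v \<bullet> (matrix_inv (lift_mat P) *v v) = (\<Sum>r\<in>UNIV. (v $ r)\<^sup>2 / d r)"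
      by (simp add: inner_vec_def inv power2_eq_square)
    then show ?thesis
      by (simp add: wnorm_def sum_nonneg d less_imp_le)
  qed
  \<comment> \<open>Division by positive diagonal entries commutes with clipping. Hence
    \<open>y\<close> is the gradient of the penalty with respect to the constraint values.\<close>
  have y_nth: "y $ r = pos_mult w $ r / d r" for r
    using d[of r] unfolding y closest_point_dual_cone
    by (auto simp: pos_mult_def inv w_def max_def zero_le_divide_iff divide_le_0_iff split: sum.split)
  have x1: "x\<^sub>1 \<in> blocks X"
    and opt: "\<And>u. u \<in> blocks X \<Longrightarrow>
      agent_sum f x\<^sub>1 + 1/2 * (\<Sum>r\<in>UNIV. (pos_mult w $ r)\<^sup>2 / d r) + \<alpha>/2 * (norm (x\<^sub>1 - x\<^sub>0))\<^sup>2
      \<le> agent_sum f u + 1/2 * (\<Sum>r\<in>UNIV. (pos_mult (c + ?G u) $ r)\<^sup>2 / d r) + \<alpha>/2 * (norm (u - x\<^sub>0))\<^sup>2"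
    using min unfolding is_arg_min_def wn closest_point_dual_cone w_def[symmetric] by (auto simp: not_less)
  \<comment> \<open>\<open>E\<close> collects the first-order coefficients along the segment, with
    convex functions replaced by their chords; \<open>F\<close> collects the quadratic ones.\<close>
  define E where "E = agent_sum f x - agent_sum f x\<^sub>1 + y \<bullet> \<delta> + \<alpha> * ((x\<^sub>1 - x\<^sub>0) \<bullet> (x - x\<^sub>1))"
  define F where "F = 1/2 * (\<Sum>r\<in>UNIV. (\<delta> $ r)\<^sup>2 / d r) + \<alpha>/2 * ((x - x\<^sub>1) \<bullet> (x - x\<^sub>1))"
  have "0 \<le> t * E + t\<^sup>2 * F" if t: "0 < t" "t \<le> 1" for t
  proof -
    define u where "u = (1 - t) *\<^sub>R x\<^sub>1 + t *\<^sub>R x"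
    have u: "u \<in> blocks X"
      unfolding u_def using convexD_alt[OF convex_blocks[OF X] x1 x] t by (simp add: add.commute)
    have f_le: "agent_sum f u \<le> agent_sum f x\<^sub>1 + t * (agent_sum f x - agent_sum f x\<^sub>1)"
      using agent_sum_convex[OF f x1 x, of t] t by (simp add: u_def algebra_simps)
    \<comment> \<open>the squared positive part is monotone, so convexity of \<open>g\<close> suffices here\<close>
    have sq: "(pos_mult (c + ?G u) $ r)\<^sup>2 \<le> (pos_mult w $ r)\<^sup>2 + 2 * t * (pos_mult w $ r * \<delta> $ r) + t\<^sup>2 * (\<delta> $ r)\<^sup>2" for r
    proof -
      obtain i s where r: "r = (i, s)" by (cases r)
      show ?thesis
      proof (cases s)
        case (Inl a)
        have "?G u $ r \<le> (1 - t) * ?G x\<^sub>1 $ r + t * ?G x $ r"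
          using convex_onD[OF g, of t "x\<^sub>1 $ i" i "x $ i" a] x x1 t
          by (simp add: r Inl g_tilde_Inl u_def blocks_def)
        then have "(c + ?G u) $ r \<le> w $ r + t * \<delta> $ r"
          by (simp add: w_def \<delta>_def algebra_simps)
        then have "(max 0 ((c + ?G u) $ r))\<^sup>2 \<le> (max 0 (w $ r + t * \<delta> $ r))\<^sup>2"
          by (intro power_mono) auto
        also have "\<dots> \<le> (max 0 (w $ r))\<^sup>2 + 2 * max 0 (w $ r) * (t * \<delta> $ r) + (t * \<delta> $ r)\<^sup>2"
          by (rule pos_part_square_le)
        finally show ?thesis
          by (simp add: pos_mult_def r Inl power_mult_distrib mult_ac)
      next
        \<comment> \<open>This coordinate is squared without clipping, and the square is not
          monotone; affinity of \<open>h\<close> supplies the exact value.\<close>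
        case (Inr b)
        have "h i (u $ i) = (1 - t) *\<^sub>R h i (x\<^sub>1 $ i) + t *\<^sub>R h i (x $ i)"
          using affine_map_on_convex_comb[OF h, of "x\<^sub>1 $ i" i "x $ i" t] x x1 u
          by (simp add: u_def blocks_def)
        then have "h i (u $ i) $ b = (1 - t) * h i (x\<^sub>1 $ i) $ b + t * h i (x $ i) $ b"
          by simp
        then have "(c + ?G u) $ r = w $ r + t * \<delta> $ r"
          by (simp add: r Inr g_tilde_Inr w_def \<delta>_def algebra_simps)
        then show ?thesis
          by (simp add: pos_mult_def r Inr power2_eq_square algebra_simps)
      qed
    qed
    have "(\<Sum>r\<in>UNIV. (pos_mult (c + ?G u) $ r)\<^sup>2 / d r)
        \<le> (\<Sum>r\<in>UNIV. ((pos_mult w $ r)\<^sup>2 + 2 * t * (pos_mult w $ r * \<delta> $ r) + t\<^sup>2 * (\<delta> $ r)\<^sup>2) / d r)"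
      by (intro sum_mono divide_right_mono sq) (simp add: d less_imp_le)
    also have "\<dots> = (\<Sum>r\<in>UNIV. (pos_mult w $ r)\<^sup>2 / d r) + 2 * t * (y \<bullet> \<delta>) + t\<^sup>2 * (\<Sum>r\<in>UNIV. (\<delta> $ r)\<^sup>2 / d r)"
      by (simp add: inner_vec_def y_nth add_divide_distrib sum.distrib sum_distrib_left mult.assoc)
    finally have g_le: "(\<Sum>r\<in>UNIV. (pos_mult (c + ?G u) $ r)\<^sup>2 / d r) \<le> \<dots>" .
    have "u - x\<^sub>0 = (x\<^sub>1 - x\<^sub>0) + t *\<^sub>R (x - x\<^sub>1)"
      by (simp add: u_def algebra_simps)
    then have n_eq: "(norm (u - x\<^sub>0))\<^sup>2 = (norm (x\<^sub>1 - x\<^sub>0))\<^sup>2 + 2 * t * ((x\<^sub>1 - x\<^sub>0) \<bullet> (x - x\<^sub>1)) + t\<^sup>2 * ((x - x\<^sub>1) \<bullet> (x - x\<^sub>1))"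
      by (simp only: power2_norm_eq_inner)
        (simp add: inner_add_left inner_add_right inner_commute power2_eq_square algebra_simps)
    have "agent_sum f x\<^sub>1 + 1/2 * (\<Sum>r\<in>UNIV. (pos_mult w $ r)\<^sup>2 / d r) + \<alpha>/2 * (norm (x\<^sub>1 - x\<^sub>0))\<^sup>2
      \<le> agent_sum f x\<^sub>1 + t * (agent_sum f x - agent_sum f x\<^sub>1)
        + 1/2 * ((\<Sum>r\<in>UNIV. (pos_mult w $ r)\<^sup>2 / d r) + 2 * t * (y \<bullet> \<delta>) + t\<^sup>2 * (\<Sum>r\<in>UNIV. (\<delta> $ r)\<^sup>2 / d r))
        + \<alpha>/2 * ((norm (x\<^sub>1 - x\<^sub>0))\<^sup>2 + 2 * t * ((x\<^sub>1 - x\<^sub>0) \<bullet> (x - x\<^sub>1)) + t\<^sup>2 * ((x - x\<^sub>1) \<bullet> (x - x\<^sub>1)))"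
      by (rule order_trans[OF opt[OF u]])
        (unfold n_eq, intro add_mono mult_left_mono f_le g_le order_refl, simp)
    then show ?thesis
      unfolding E_def F_def by (simp add: field_simps)
  qed
  then have "0 \<le> E" by (rule first_order_term_nonneg)
  then show ?thesis
    unfolding E_def \<delta>_def by (simp add: inner_diff_right algebra_simps)
qed

text \<open>Zero duality gap equates the optimal cost with the dual value, a lower bound of the
  Lagrangian on \<open>blocks X\<close>. At \<open>x\<^sub>s\<close> this makes the multiplier term
  nonnegative while feasibility makes it nonpositive, which is complementary slackness.\<close>

lemma primal_dual_optimal_saddle:
  fixes X :: "'n::finite \<Rightarrow> (real^'d::finite) set"
    and g :: "'n \<Rightarrow> real^'d \<Rightarrow> real^'m::finite" and h :: "'n \<Rightarrow> real^'d \<Rightarrow> real^'p::finite"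
  assumes "primal_dual_optimal X f g h x\<^sub>s \<mu> lam"
  shows "cc_feasible X g h x\<^sub>s" and "nonneg \<mu>"
    and "x \<in> blocks X \<Longrightarrow> agent_sum f x\<^sub>s \<le> agent_sum f x + consensus (stack \<mu> lam) \<bullet> g_tilde g h x"
    and "consensus (stack \<mu> lam) \<bullet> g_tilde g h x\<^sub>s = 0"
proof -
  have dual: "ereal (agent_sum f x\<^sub>s) = dual_fun X f g h (\<mu>, lam)"
    using assms unfolding primal_dual_optimal_def by blast
  show feas: "cc_feasible X g h x\<^sub>s" and \<mu>: "nonneg \<mu>"
    using assms by (auto simp: primal_dual_optimal_def cc_optimal_def is_arg_min_def is_arg_max_def)
  have lag: "lagrangian f g h x \<mu> lam = agent_sum f x + consensus (stack \<mu> lam) \<bullet> g_tilde g h x" for x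
    by (simp add: lagrangian_def inner_consensus block_sum_g_tilde inner_stack)
  show saddle: "agent_sum f x\<^sub>s \<le> agent_sum f x + consensus (stack \<mu> lam) \<bullet> g_tilde g h x" if "x \<in> blocks X" for x
  proof -
    have "ereal (agent_sum f x\<^sub>s) \<le> ereal (lagrangian f g h x \<mu> lam)"
      unfolding dual dual_fun_def using that by (auto intro: INF_lower)
    then show ?thesis by (simp add: lag)
  qed
  have xs: "x\<^sub>s \<in> blocks X" and gs: "\<And>a. agent_sum g x\<^sub>s $ a \<le> 0" and hs: "agent_sum h x\<^sub>s = 0"
    using feas by (auto simp: cc_feasible_def)
  have "consensus (stack \<mu> lam) \<bullet> g_tilde g h x\<^sub>s = \<mu> \<bullet> agent_sum g x\<^sub>s"
    by (simp add: inner_consensus block_sum_g_tilde inner_stack hs)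
  moreover have "\<mu> \<bullet> agent_sum g x\<^sub>s \<le> 0"
    using \<mu> gs unfolding inner_vec_def nonneg_def by (intro sum_nonpos) (auto simp: mult_le_0_iff)
  ultimately show "consensus (stack \<mu> lam) \<bullet> g_tilde g h x\<^sub>s = 0"
    using saddle[OF xs] by linarith
qed

section \<open>The dual step and the Lyapunov function\<close>

text \<open>The slack \<open>s\<close> is the negative part of \<open>w\<close> on the inequality
  coordinates, so it vanishes wherever clipping is inactive. Positive diagonal scaling carries this
  complementarity over to \<open>y\<close>.\<close>

lemma dual_step:
  fixes P :: "real^'n^'n" and w y s :: "real^('n \<times> ('m::finite + 'p::finite))"
  assumes P: "sym_pd P" "diag_mat P"
    and y: "y = closest_point dual_cone (matrix_inv (lift_mat P) *v w)"
    and s: "s = lift_mat P *v y - w"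
  shows "y \<in> dual_cone" "s \<in> dual_cone" "s $ (i, Inr b) = 0" "s \<bullet> y = 0"
proof -
  have d: "0 < P $ i $ i" for i using sym_pd_diag_pos[OF P(1)] .
  have y_nth: "P $ fst r $ fst r * y $ r = pos_mult w $ r" for r
    using d[of "fst r"] unfolding y closest_point_dual_cone
    by (auto simp: pos_mult_def matrix_inv_lift_mat_diag_nth[OF P] max_def field_simps split: sum.split)
  have s_nth: "s $ r = pos_mult w $ r - w $ r" for r
    by (simp add: s lift_mat_diag_nth[OF P(2)] y_nth)
  show "y \<in> dual_cone"
    unfolding y closest_point_dual_cone by (simp add: pos_mult_def dual_cone_def)
  show "s \<in> dual_cone" "s $ (i, Inr b) = 0"
    by (simp_all add: dual_cone_def s_nth pos_mult_def)
  have "s $ r * y $ r = 0" for r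
  proof -
    have "s $ r * pos_mult w $ r = 0"
      by (simp add: s_nth pos_mult_def max_def split: sum.split)
    then show ?thesis using y_nth[of r] d[of "fst r"] by auto
  qed
  then show "s \<bullet> y = 0" unfolding inner_vec_def by (intro sum.neutral) simp
qed

text \<open>The equality coordinates of \<open>dual_cone\<close> are free, so the cone is not
  self-dual; the third assumption puts \<open>u\<close> into the cone that pairs nonnegatively with
  it.\<close>

lemma inner_dual_cone_nonneg:
  fixes u v :: "real^('n::finite \<times> ('m::finite + 'p::finite))"
  assumes "u \<in> dual_cone" "v \<in> dual_cone" "\<And>i b. u $ (i, Inr b) = 0"
  shows "0 \<le> u \<bullet> v"
proof -
  have "0 \<le> u $ r * v $ r" for r
    using assms by (cases r; cases "snd r") (auto simp: dual_cone_def)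
  then show ?thesis by (simp add: inner_vec_def sum_nonneg)
qed

text \<open>The range of a symmetric matrix is orthogonal to its null space, and
  \<open>block_sum\<close> tests against consensus vectors.\<close>

lemma block_sum_mult_eq_0:
  fixes M :: "real^('n::finite \<times> 'q::finite)^('n \<times> 'q)"
  assumes "transpose M = M" "\<And>u. M *v consensus u = 0"
  shows "block_sum (M *v v) = 0"
proof -
  have "block_sum (M *v v) \<bullet> block_sum (M *v v) = consensus (block_sum (M *v v)) \<bullet> (M *v v)"
    by (simp add: inner_consensus)
  also have "\<dots> = 0"
    by (simp add: assms symmetric_matrix_inner[OF assms(1), symmetric])
  finally show ?thesis by simp
qed

text \<open>\<open>S ** pinv S\<close> is the orthogonal projection onto the range of
  \<open>S\<close>, whose complement is the null space.\<close>

lemma mult_pinv_residual: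
  fixes S :: "real^'n^'n"
  assumes S: "transpose S = S"
  shows "S *v (v - S *v (pinv S *v v)) = 0"
proof -
  have p: "S ** pinv S ** S = S" "transpose (S ** pinv S) = S ** pinv S"
    using penrose_inverse_pinv[OF S] by (auto simp: penrose_inverse_def)
  have "S ** (S ** pinv S) = transpose (S ** pinv S ** S)"
    by (simp add: matrix_transpose_mul[of "S ** pinv S"] S p(2))
  then have "S ** (S ** pinv S) = S" by (simp add: p(1) S)
  then show ?thesis
    by (simp add: matrix_vector_mult_diff_distrib matrix_vector_mul_assoc matrix_mul_assoc)
qed

text \<open>
  The orthogonal projection onto the range of the square root. Since the initial \<open>z\<close> is arbitrary, the
  Lyapunov function must ignore the component of \<open>z\<close> in the null space.
\<close>

definition sqrt_range_proj :: "real^'n^'n \<Rightarrow> real^'n^'n" where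
  "sqrt_range_proj M = psd_sqrt M ** pinv M ** psd_sqrt M"

text \<open>\<open>pinv M ** M\<close> and \<open>M ** pinv M\<close> fix every vector up to the
  null space of \<open>M\<close>. The square root has the same null space and does not see the
  difference.\<close>

lemma
  fixes M :: "real^'n^'n"
  assumes M: "sym_psd M"
  shows sqrt_range_proj_mult_sqrt: "sqrt_range_proj M *v (psd_sqrt M *v v) = psd_sqrt M *v v"
    and sqrt_mult_sqrt_range_proj: "psd_sqrt M *v (sqrt_range_proj M *v v) = psd_sqrt M *v v"
    and wnorm_pinv_sqrt: "(wnorm (pinv M) (psd_sqrt M *v v))\<^sup>2 = v \<bullet> (sqrt_range_proj M *v v)"
    and sqrt_range_proj_nonneg: "0 \<le> v \<bullet> (sqrt_range_proj M *v v)"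
proof -
  let ?S = "psd_sqrt M" and ?R = "pinv M"
  have symM: "transpose M = M" and symS: "transpose ?S = ?S" and SS: "?S ** ?S = M"
    using M psd_sqrt[OF M] by (auto simp: sym_psd_def)
  have R: "M ** ?R ** M = M" "transpose (M ** ?R) = M ** ?R" "transpose (?R ** M) = ?R ** M"
    using penrose_inverse_pinv[OF symM] by (auto simp: penrose_inverse_def)
  have null: "?S *v u = 0" if "M *v u = 0" for u
    using symmetric_square_null[OF symS, of u] that by (simp add: matrix_vector_mul_assoc SS)
  have "?S *v ((?R ** M) *v u - u) = 0" for u
    by (rule null) (simp add: matrix_vector_mult_diff_distrib matrix_vector_mul_assoc matrix_mul_assoc R)
  then have SRM: "?S ** (?R ** M) = ?S"
    by (simp add: matrix_eq matrix_vector_mult_diff_distrib matrix_vector_mul_assoc)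
  have "M ** (M ** ?R) = transpose (M ** ?R ** M)"
    by (simp add: matrix_transpose_mul[of "M ** ?R"] symM R(2))
  then have MMR: "M ** (M ** ?R) = M" by (simp add: R(1) symM)
  have "?S *v ((M ** ?R) *v u - u) = 0" for u
    by (rule null) (simp add: matrix_vector_mult_diff_distrib matrix_vector_mul_assoc MMR)
  then have "?S ** (M ** ?R) = ?S"
    by (simp add: matrix_eq matrix_vector_mult_diff_distrib matrix_vector_mul_assoc)
  then have "transpose (?S ** (M ** ?R)) = ?S" by (simp add: symS)
  then have MRS: "M ** ?R ** ?S = ?S"
    by (simp add: matrix_transpose_mul[of ?S] symS R(2))
  have "sqrt_range_proj M ** ?S = ?S ** (?R ** (?S ** ?S))"
    by (simp add: sqrt_range_proj_def matrix_mul_assoc)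
  then show "sqrt_range_proj M *v (?S *v v) = ?S *v v"
    by (simp add: matrix_vector_mul_assoc SS SRM)
  have "?S ** sqrt_range_proj M = (?S ** ?S) ** ?R ** ?S"
    by (simp add: sqrt_range_proj_def matrix_mul_assoc)
  then show "?S *v (sqrt_range_proj M *v v) = ?S *v v"
    by (simp add: matrix_vector_mul_assoc SS MRS)
  have eq: "(?S *v v) \<bullet> (?R *v (?S *v v)) = v \<bullet> (sqrt_range_proj M *v v)"
    by (simp add: symmetric_matrix_inner[OF symS] sqrt_range_proj_def matrix_vector_mul_assoc matrix_mul_assoc)
  \<comment> \<open>The form of \<open>pinv M\<close> at this point equals that of \<open>M\<close>
    at \<open>u\<close>, which is nonnegative by hypothesis.\<close>
  define u where "u = ?R *v (?S *v v)"
  have "?S *v v = M *v u"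
    by (simp add: u_def matrix_vector_mul_assoc matrix_mul_assoc MRS)
  then have "0 \<le> (?S *v v) \<bullet> u"
    using M by (simp add: sym_psd_def inner_commute)
  then show nonneg: "0 \<le> v \<bullet> (sqrt_range_proj M *v v)"
    by (simp add: eq u_def)
  show "(wnorm ?R (?S *v v))\<^sup>2 = v \<bullet> (sqrt_range_proj M *v v)"
    by (simp add: wnorm_def eq nonneg)
qed

text \<open>Inserting \<open>gx\<close> turns \<open>mono\<close> into differences of squares. The
  cross term \<open>e \<bullet> (S *v y\<^sub>1)\<close> cancels against the one created by the
  update of \<open>z\<close>, and the leftover square of the increment is absorbed by the form of
  \<open>H\<close>.\<close>

lemma lyapunov_descent:
  fixes A H S Q :: "real^'r^'r" and x\<^sub>0 x\<^sub>1 x\<^sub>s :: "'e::real_inner" and Y :: "real^'r"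
  assumes \<rho>: "0 < \<rho>"
    and A: "sym_psd A" and H: "transpose H = H" and S: "transpose S = S"
    and S_le_H: "\<And>v. (S *v v) \<bullet> (S *v v) \<le> v \<bullet> (H *v v)"
    and Q: "\<And>v. Q *v (S *v v) = S *v v" "\<And>v. S *v (Q *v v) = S *v v"
    and Y: "H *v Y = 0" "S *v Y = 0"
    and gx: "gx = A *v (y\<^sub>1 - y\<^sub>0) + \<rho> *\<^sub>R (H *v y\<^sub>1) + S *v z\<^sub>0 - s"
    and s: "s \<bullet> y\<^sub>1 = 0" "0 \<le> s \<bullet> Y"
    and gs: "Y \<bullet> gs = 0" "y\<^sub>1 \<bullet> gs \<le> y\<^sub>1 \<bullet> (S *v z\<^sub>s)"
    and z\<^sub>1: "z\<^sub>1 = z\<^sub>0 + \<rho> *\<^sub>R (S *v y\<^sub>1)"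
    and mono: "(y\<^sub>1 - Y) \<bullet> (gx - gs) + \<alpha> * ((x\<^sub>1 - x\<^sub>0) \<bullet> (x\<^sub>1 - x\<^sub>s)) \<le> 0"
  defines "V \<equiv> \<lambda>y x z. (y - Y) \<bullet> (A *v (y - Y)) + \<alpha> * ((x - x\<^sub>s) \<bullet> (x - x\<^sub>s))
    + 1/\<rho> * ((z - z\<^sub>s) \<bullet> (Q *v (z - z\<^sub>s)))"
  assumes \<alpha>: "0 \<le> \<alpha>"
  shows "V y\<^sub>1 x\<^sub>1 z\<^sub>1 \<le> V y\<^sub>0 x\<^sub>0 z\<^sub>0"
proof -
  define a b p q e where "a = y\<^sub>1 - Y" and "b = y\<^sub>0 - Y" and "p = x\<^sub>1 - x\<^sub>s" and "q = x\<^sub>0 - x\<^sub>s" and "e = z\<^sub>0 - z\<^sub>s"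
  have symA: "transpose A = A" and posA: "0 \<le> v \<bullet> (A *v v)" for v
    using A by (auto simp: sym_psd_def)
  have ab: "y\<^sub>1 - y\<^sub>0 = a - b" and pq: "x\<^sub>1 - x\<^sub>0 = p - q" by (simp_all add: a_def b_def p_def q_def)
  \<comment> \<open>Both \<open>H\<close> and \<open>S\<close> annihilate \<open>Y\<close>, so in
    their terms \<open>a\<close> can be replaced by \<open>y\<^sub>1\<close>.\<close>
  have "a \<bullet> (H *v y\<^sub>1) = y\<^sub>1 \<bullet> (H *v y\<^sub>1)"
    using symmetric_matrix_inner[OF H, of Y y\<^sub>1] by (simp add: a_def inner_diff_left Y)
  moreover have "a \<bullet> (S *v z\<^sub>0) = y\<^sub>1 \<bullet> (S *v z\<^sub>0)"
    using symmetric_matrix_inner[OF S, of Y z\<^sub>0] by (simp add: a_def inner_diff_left Y)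
  moreover have "a \<bullet> s \<le> 0" using s by (simp add: a_def inner_diff_right inner_commute[of _ s])
  moreover have "a \<bullet> gs \<le> y\<^sub>1 \<bullet> (S *v z\<^sub>s)" using gs by (simp add: a_def inner_diff_left)
  moreover have "y\<^sub>1 \<bullet> (S *v z\<^sub>0) - y\<^sub>1 \<bullet> (S *v z\<^sub>s) = e \<bullet> (S *v y\<^sub>1)"
  proof -
    have "y\<^sub>1 \<bullet> (S *v e) = e \<bullet> (S *v y\<^sub>1)"
      by (metis symmetric_matrix_inner[OF S] inner_commute)
    then show ?thesis
      by (simp add: e_def matrix_vector_mult_diff_distrib inner_diff_right)
  qed
  moreover have "a \<bullet> (gx - gs) + \<alpha> * ((p - q) \<bullet> p) \<le> 0"
    using mono unfolding pq by (simp add: a_def p_def)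
  moreover have "a \<bullet> gx = a \<bullet> (A *v (a - b)) + \<rho> * (a \<bullet> (H *v y\<^sub>1)) + a \<bullet> (S *v z\<^sub>0) - a \<bullet> s"
    unfolding gx ab by (simp add: inner_add_right inner_diff_right)
  ultimately have main:
    "a \<bullet> (A *v (a - b)) + \<rho> * (y\<^sub>1 \<bullet> (H *v y\<^sub>1)) + e \<bullet> (S *v y\<^sub>1) + \<alpha> * ((p - q) \<bullet> p) \<le> 0"
    by (simp add: inner_diff_right)
  \<comment> \<open>The three-point identity; its last square is nonnegative and is discarded at the
    end.\<close>
  have A_id: "2 * (a \<bullet> (A *v (a - b))) = a \<bullet> (A *v a) - b \<bullet> (A *v b) + (a - b) \<bullet> (A *v (a - b))"
    using symmetric_matrix_inner[OF symA, of a b]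
    by (simp add: matrix_vector_mult_diff_distrib inner_diff_left inner_diff_right inner_commute)
  have p_id: "2 * ((p - q) \<bullet> p) = p \<bullet> p - q \<bullet> q + (p - q) \<bullet> (p - q)"
    by (simp add: inner_diff_left inner_diff_right inner_commute)
  \<comment> \<open>\<open>Q\<close> acts as the identity next to \<open>S\<close> on either side,
    so it survives only in the term for \<open>e\<close>.\<close>
  have z_id: "(z\<^sub>1 - z\<^sub>s) \<bullet> (Q *v (z\<^sub>1 - z\<^sub>s))
      = e \<bullet> (Q *v e) + 2 * \<rho> * (e \<bullet> (S *v y\<^sub>1)) + \<rho>\<^sup>2 * ((S *v y\<^sub>1) \<bullet> (S *v y\<^sub>1))"
  proof -
    have "z\<^sub>1 - z\<^sub>s = e + \<rho> *\<^sub>R (S *v y\<^sub>1)" by (simp add: z\<^sub>1 e_def)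
    moreover have "(S *v y\<^sub>1) \<bullet> (Q *v e) = e \<bullet> (S *v y\<^sub>1)"
      by (metis symmetric_matrix_inner[OF S] Q(2) inner_commute)
    ultimately show ?thesis
      by (simp add: matrix_vector_right_distrib matrix_vector_mult_scaleR Q inner_add_left inner_add_right
          power2_eq_square algebra_simps)
  qed
  have "\<rho> * ((S *v y\<^sub>1) \<bullet> (S *v y\<^sub>1)) \<le> 2 * \<rho> * (y\<^sub>1 \<bullet> (H *v y\<^sub>1))"
  proof -
    have "(S *v y\<^sub>1) \<bullet> (S *v y\<^sub>1) \<le> 2 * (y\<^sub>1 \<bullet> (H *v y\<^sub>1))"
      using S_le_H[of y\<^sub>1] inner_ge_zero[of "S *v y\<^sub>1"] by linarith
    then show ?thesis using \<rho> by (simp add: mult.assoc)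
  qed
  moreover have "1/\<rho> * ((z\<^sub>1 - z\<^sub>s) \<bullet> (Q *v (z\<^sub>1 - z\<^sub>s)))
      = 1/\<rho> * (e \<bullet> (Q *v e)) + 2 * (e \<bullet> (S *v y\<^sub>1)) + \<rho> * ((S *v y\<^sub>1) \<bullet> (S *v y\<^sub>1))"
    unfolding z_id using \<rho> by (simp add: field_simps power2_eq_square)
  moreover have "2 * (\<alpha> * ((p - q) \<bullet> p)) = \<alpha> * (p \<bullet> p) - \<alpha> * (q \<bullet> q) + \<alpha> * ((p - q) \<bullet> (p - q))"
    using p_id by algebra
  moreover have "0 \<le> \<alpha> * ((p - q) \<bullet> (p - q))" using \<alpha> by simp
  ultimately show ?thesis
    using main A_id posA[of "a - b"]
    unfolding V_def a_def[symmetric] b_def[symmetric] p_def[symmetric] q_def[symmetric] e_def[symmetric]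
    by linarith
qed

section \<open>Convex and affine functions at running averages\<close>

lemma running_avg_nth: "running_avg x k $ i = running_avg (\<lambda>l. x l $ i) k"
  by (simp add: running_avg_def)

lemma convex_on_running_avg_le:
  assumes F: "convex_on S F" and x: "\<And>l. l \<in> {1..k} \<Longrightarrow> x l \<in> S" and k: "1 \<le> k"
  shows "F (running_avg x k) \<le> 1 / real k * (\<Sum>l=1..k. F (x l))"
proof -
  have "F (\<Sum>l\<in>{1..k}. (1 / real k) *\<^sub>R x l) \<le> (\<Sum>l\<in>{1..k}. 1 / real k * F (x l))"
    using k x by (intro convex_on_sum[OF _ _ F]) auto
  then show ?thesis by (simp only: running_avg_def scaleR_sum_right sum_distrib_left)
qed

lemma running_avg_mem:
  assumes "convex S" and x: "\<And>l. l \<in> {1..k} \<Longrightarrow> x l \<in> S" and k: "1 \<le> k"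
  shows "running_avg x k \<in> S"
  unfolding running_avg_def scaleR_sum_right
  using k x by (intro convex_sum[OF _ assms(1)]) auto

text \<open>\<open>F\<close> agrees with an affine map only on \<open>S\<close>, so the average must
  be placed in \<open>S\<close> before linearity applies.\<close>

lemma affine_map_on_running_avg:
  assumes F: "affine_map_on S F" and S: "convex S" and x: "\<And>l. l \<in> {1..k} \<Longrightarrow> x l \<in> S" and k: "1 \<le> k"
  shows "F (running_avg x k) = (1 / real k) *\<^sub>R (\<Sum>l=1..k. F (x l))"
proof -
  obtain L c where L: "linear L" "\<And>x. x \<in> S \<Longrightarrow> F x = L x + c"
    using F unfolding affine_map_on_def by blast
  have "F (running_avg x k) = (1 / real k) *\<^sub>R (\<Sum>l=1..k. L (x l)) + c"
    by (simp only: L(2) running_avg_mem[OF S x k])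
      (simp add: running_avg_def linear_scale[OF L(1)] linear_sum[OF L(1)])
  also have "\<dots> = (1 / real k) *\<^sub>R (\<Sum>l=1..k. L (x l) + c)"
    using k by (simp add: sum.distrib scaleR_add_right sum_constant_scaleR)
  also have "\<dots> = (1 / real k) *\<^sub>R (\<Sum>l=1..k. F (x l))"
    using x by (simp add: L(2))
  finally show ?thesis .
qed

section \<open>The feasibility bound\<close>

theorem theorem4:
  fixes J :: "'n::finite \<Rightarrow> 'd::finite set"
    and X :: "'n \<Rightarrow> (real^'d) set"
    and f :: "'n \<Rightarrow> real^'d \<Rightarrow> real"
    and g :: "'n \<Rightarrow> real^'d \<Rightarrow> real^'m::finite"
    and h :: "'n \<Rightarrow> real^'d \<Rightarrow> real^'p::finite"
    and P\<^sub>A P\<^sub>H P\<^sub>H\<^sub>t :: "real^'n^'n"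
    and \<rho> \<alpha> :: real
    and x\<^sub>s :: "real^'d^'n" and \<mu>\<^sub>s :: "real^'m" and lam\<^sub>s :: "real^'p"
    and x :: "nat \<Rightarrow> real^'d^'n"
    and y z :: "nat \<Rightarrow> real^('n \<times> ('m + 'p))"
    and z\<^sub>s :: "real^('n \<times> ('m + 'p))"
    and S\<^sub>H\<^sub>t :: "real^('n \<times> ('m + 'p))^('n \<times> ('m + 'p))"
    and C1 C2 :: real
    and k :: nat
  assumes "\<And>i. X i \<subseteq> coord_space (J i)"
    and "\<rho> > 0" and "\<alpha> > 0"
    and "\<And>i. convex (X i)"
    and "\<And>i. convex_on (X i) (f i)"
    and "\<And>i a. convex_on (X i) (\<lambda>v. g i v $ a)"
    and "\<And>i. affine_map_on (X i) (h i)"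
    and "\<exists>x'. cc_optimal X f g h x'"
    and "slater X g h"
    and "sym_psd P\<^sub>A" and "sym_psd P\<^sub>H" and "sym_psd P\<^sub>H\<^sub>t"
    and "sym_pd (P\<^sub>A + \<rho> *\<^sub>R P\<^sub>H)"
    and "sym_psd (P\<^sub>H - P\<^sub>H\<^sub>t)"
    and "null_sp P\<^sub>H = span {1}" and "null_sp P\<^sub>H\<^sub>t = span {1}"
    and "diag_mat (P\<^sub>A + \<rho> *\<^sub>R P\<^sub>H)"
    and "primal_dual_optimal X f g h x\<^sub>s \<mu>\<^sub>s lam\<^sub>s"
    and "pro_duca J X f g h P\<^sub>A P\<^sub>H P\<^sub>H\<^sub>t \<rho> \<alpha> x y z"
    and "S\<^sub>H\<^sub>t = psd_sqrt (lift_mat P\<^sub>H\<^sub>t)"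
    and "z\<^sub>s = pinv S\<^sub>H\<^sub>t *v g_tilde g h x\<^sub>s"
    and "C1 = sqrt (real CARD('n) * max_eigenvalue P\<^sub>A) * norm (stack \<mu>\<^sub>s lam\<^sub>s)"
    and "C2 = sqrt ((wnorm (lift_mat P\<^sub>A) (y 0) + C1)\<^sup>2
                    + \<alpha> * (norm (x 0 - x\<^sub>s))\<^sup>2
                    + 1/\<rho> * (wnorm (pinv (lift_mat P\<^sub>H\<^sub>t)) (S\<^sub>H\<^sub>t *v z 0 - S\<^sub>H\<^sub>t *v z\<^sub>s))\<^sup>2)"
    and "k \<ge> 1"
  shows "norm (stack (pos_part (agent_sum g (running_avg x k))) (agent_sum h (running_avg x k)))
    \<le> sqrt (real CARD('n) * max_eigenvalue P\<^sub>A) / real k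
        * (wnorm (lift_mat P\<^sub>A) (y 0) + C1 + C2)"
proof -
  let ?A = "lift_mat P\<^sub>A :: real^('n \<times> ('m + 'p))^('n \<times> ('m + 'p))"
  let ?H = "lift_mat P\<^sub>H :: real^('n \<times> ('m + 'p))^('n \<times> ('m + 'p))"
  let ?Ht = "lift_mat P\<^sub>H\<^sub>t :: real^('n \<times> ('m + 'p))^('n \<times> ('m + 'p))"
  let ?P = "P\<^sub>A + \<rho> *\<^sub>R P\<^sub>H"
  let ?S = S\<^sub>H\<^sub>t and ?Q = "sqrt_range_proj ?Ht" and ?G = "g_tilde g h"
  define Y :: "real^('n \<times> ('m + 'p))" where "Y = consensus (stack \<mu>\<^sub>s lam\<^sub>s)"
  define w where "w j = ?A *v y j - ?S *v z j + ?G (x (Suc j))" for j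
  \<comment> \<open>The slack of the step from \<open>j\<close> to \<open>Suc j\<close>: it is
    complementary to \<open>y (Suc j)\<close>, not to \<open>y j\<close>.\<close>
  define s where "s j = lift_mat ?P *v y (Suc j) - w j" for j
  \<comment> \<open>The last term is written with \<open>?Q\<close> acting on \<open>z\<close>,
    which suits the update of \<open>z\<close>; \<open>wnorm_pinv_sqrt\<close> translates it into
    the pseudoinverse norm for the initial value.\<close>
  define V where "V = (\<lambda>j. (y j - Y) \<bullet> (?A *v (y j - Y)) + \<alpha> * ((x j - x\<^sub>s) \<bullet> (x j - x\<^sub>s))
    + 1/\<rho> * ((z j - z\<^sub>s) \<bullet> (?Q *v (z j - z\<^sub>s))))"
  note P = \<open>sym_pd ?P\<close> \<open>diag_mat ?P\<close>

  \<comment> \<open>Null spaces and ordering of the lifted matrices\<close>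
  have D: "lift_mat ?P = ?A + \<rho> *\<^sub>R ?H"
    by (rule lift_mat_add_scaleR)
  have psd: "sym_psd ?A" "sym_psd ?H" "sym_psd ?Ht"
    using assms by (simp_all add: sym_psd_lift_mat)
  have S: "transpose ?S = ?S" and SS: "?S ** ?S = ?Ht"
    using psd_sqrt[OF psd(3)] \<open>S\<^sub>H\<^sub>t = psd_sqrt ?Ht\<close> by (auto simp: sym_psd_def)
  have H: "transpose ?H = ?H" using psd(2) by (simp add: sym_psd_def)
  have H_cons: "?H *v consensus u = 0" for u
    using lift_mat_null_iff_consensus[OF \<open>null_sp P\<^sub>H = span {1}\<close>] by blast
  have Ht_null: "?Ht *v v = 0 \<longleftrightarrow> (\<exists>u. v = consensus u)" for v
    by (rule lift_mat_null_iff_consensus[OF \<open>null_sp P\<^sub>H\<^sub>t = span {1}\<close>])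
  have S_cons: "?S *v consensus u = 0" for u
    using symmetric_square_null[OF S] Ht_null by (metis matrix_vector_mul_assoc SS)
  have S_null: "\<exists>u. v = consensus u" if "?S *v v = 0" for v
    using that Ht_null[of v] by (simp flip: SS matrix_vector_mul_assoc)
  have SS_le_H: "(?S *v v) \<bullet> (?S *v v) \<le> v \<bullet> (?H *v v)" for v
  proof -
    have "0 \<le> v \<bullet> (lift_mat (P\<^sub>H - P\<^sub>H\<^sub>t) *v v)"
      using sym_psd_lift_mat[OF \<open>sym_psd (P\<^sub>H - P\<^sub>H\<^sub>t)\<close>] unfolding sym_psd_def by blast
    then have "v \<bullet> (?Ht *v v) \<le> v \<bullet> (?H *v v)"
      by (simp add: lift_mat_diff matrix_vector_mult_diff_rdistrib inner_diff_right)
    moreover have "(?S *v v) \<bullet> (?S *v v) = v \<bullet> (?Ht *v v)"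
      by (simp add: symmetric_matrix_inner[OF S] matrix_vector_mul_assoc SS)
    ultimately show ?thesis by simp
  qed
  note block_sum_H = block_sum_mult_eq_0[OF H H_cons] and block_sum_S = block_sum_mult_eq_0[OF S S_cons]
  note saddle = primal_dual_optimal_saddle[OF \<open>primal_dual_optimal X f g h x\<^sub>s \<mu>\<^sub>s lam\<^sub>s\<close>]
  have gs_le: "agent_sum g x\<^sub>s $ a \<le> 0" for a
    using saddle(1) by (simp add: cc_feasible_def)
  have hs: "agent_sum h x\<^sub>s = 0" and xs: "x\<^sub>s \<in> blocks X"
    using saddle(1) by (auto simp: cc_feasible_def)
  have Y_cone: "Y \<in> dual_cone"
    using saddle(2) by (simp add: Y_def consensus_def stack_def dual_cone_def nonneg_def)

  \<comment> \<open>One iteration as a slack equation\<close>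
  have min: "is_arg_min
      (\<lambda>x'. agent_sum f x'
        + 1/2 * (wnorm (matrix_inv (lift_mat ?P))
            (closest_point dual_cone (?A *v y j - ?S *v z j + ?G x')))\<^sup>2
        + \<alpha>/2 * (norm (x' - x j))\<^sup>2) (\<lambda>x'. x' \<in> blocks X) (x (Suc j))"
    and y_Suc: "y (Suc j) = closest_point dual_cone (matrix_inv (lift_mat ?P) *v w j)"
    and z_Suc: "z (Suc j) = z j + \<rho> *\<^sub>R (?S *v y (Suc j))" for j
    using \<open>pro_duca J X f g h P\<^sub>A P\<^sub>H P\<^sub>H\<^sub>t \<rho> \<alpha> x y z\<close> \<open>S\<^sub>H\<^sub>t = psd_sqrt ?Ht\<close>
    unfolding pro_duca_def Let_def D w_def by blast+
  note dual = dual_step[OF P y_Suc s_def]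
  have x_mem: "x (Suc j) \<in> blocks X" for j
    using min[of j] by (simp add: is_arg_min_def)
  have G_eq: "?G (x (Suc j)) = ?A *v (y (Suc j) - y j) + \<rho> *\<^sub>R (?H *v y (Suc j)) + ?S *v z j - s j" for j
    unfolding s_def w_def D
    by (simp add: matrix_vector_mult_add_rdistrib scaleR_matrix_vector_assoc[symmetric]
        matrix_vector_mult_diff_distrib)

  have y_gs: "y (Suc j) \<bullet> ?G x\<^sub>s \<le> y (Suc j) \<bullet> (?S *v z\<^sub>s)" for j
  proof -
    \<comment> \<open>The part of the constraint values outside the range of \<open>?S\<close>. It
      is the consensus vector of their average over the agents, which feasibility makes nonpositive
      for inequalities and zero for equalities.\<close>
    define r where "r = ?G x\<^sub>s - ?S *v z\<^sub>s"
    have "?S *v r = 0"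
      unfolding r_def \<open>z\<^sub>s = pinv S\<^sub>H\<^sub>t *v g_tilde g h x\<^sub>s\<close> by (rule mult_pinv_residual[OF S])
    then obtain u where u: "r = consensus u" using S_null by blast
    have "real CARD('n) *\<^sub>R u = block_sum r" by (simp add: u block_sum_consensus)
    also have "\<dots> = stack (agent_sum g x\<^sub>s) 0"
      by (simp add: r_def block_sum_linear block_sum_S block_sum_g_tilde hs)
    finally have Nu: "real CARD('n) * u $ c = stack (agent_sum g x\<^sub>s) 0 $ c" for c
      by (metis vector_scaleR_component real_scaleR_def)
    have "0 \<le> (- r) \<bullet> y (Suc j)"
    proof (rule inner_dual_cone_nonneg[OF _ dual(1)])
      have "u $ Inl a \<le> 0" for a
        using Nu[of "Inl a"] gs_le[of a] by (simp add: stack_def) (metis gs_le mult_le_0_iff of_nat_0_le_iff zero_less_card_finite of_nat_0_less_iff not_le)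
      then show "- r \<in> dual_cone" by (simp add: u consensus_def dual_cone_def)
      show "(- r) $ (i, Inr b) = 0" for i b
        using Nu[of "Inr b"] by (simp add: u consensus_def stack_def)
    qed
    then show ?thesis by (simp add: r_def inner_diff_left inner_diff_right inner_commute)
  qed

  \<comment> \<open>Descent of the Lyapunov function\<close>
  have V_dec: "V (Suc j) \<le> V j" for j
    unfolding V_def
  proof (rule lyapunov_descent[where H = ?H and S = ?S and s = "s j" and gx = "?G (x (Suc j))" and gs = "?G x\<^sub>s"])
    show "?Q *v (?S *v v) = ?S *v v" "?S *v (?Q *v v) = ?S *v v" for v
      unfolding \<open>S\<^sub>H\<^sub>t = psd_sqrt ?Ht\<close>
      by (rule sqrt_range_proj_mult_sqrt[OF psd(3)] sqrt_mult_sqrt_range_proj[OF psd(3)])+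
    show "0 \<le> s j \<bullet> Y"
      by (rule inner_dual_cone_nonneg[OF dual(2) Y_cone dual(3)])
    show "(y (Suc j) - Y) \<bullet> (?G (x (Suc j)) - ?G x\<^sub>s)
        + \<alpha> * ((x (Suc j) - x j) \<bullet> (x (Suc j) - x\<^sub>s)) \<le> 0"
    proof -
      \<comment> \<open>The primal step is tested at \<open>x\<^sub>s\<close>; adding the saddle
        inequality at \<open>x (Suc j)\<close> cancels the costs.\<close>
      have "agent_sum f (x (Suc j)) + y (Suc j) \<bullet> ?G (x (Suc j)) + \<alpha> * ((x (Suc j) - x j) \<bullet> (x (Suc j) - x\<^sub>s))
        \<le> agent_sum f x\<^sub>s + y (Suc j) \<bullet> ?G x\<^sub>s"
        by (rule primal_step_inequality[OF assms(4-7) P min y_Suc[unfolded w_def] xs])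
      then show ?thesis
        using saddle(3)[OF x_mem, of j] saddle(4)
        by (simp add: inner_diff_left inner_diff_right flip: Y_def)
    qed
  show "?H *v Y = 0" "?S *v Y = 0"
      by (simp_all add: Y_def H_cons S_cons)
  qed (use psd H S SS_le_H H_cons S_cons G_eq dual(4) saddle(4) y_gs z_Suc \<open>\<rho> > 0\<close> \<open>\<alpha> > 0\<close> in
      \<open>simp_all flip: Y_def\<close>)
  have V_le: "V k \<le> V 0" by (induction k) (auto intro: V_dec order_trans)

  \<comment> \<open>Distance travelled by the multipliers\<close>
  define K where "K = sqrt (real CARD('n) * max_eigenvalue P\<^sub>A)"
  have Y_le: "wnorm ?A Y \<le> C1"
    unfolding Y_def \<open>C1 = _\<close> by (rule wnorm_lift_mat_consensus_le[OF \<open>sym_psd P\<^sub>A\<close>])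
  have y0_le: "wnorm ?A (y 0 - Y) \<le> wnorm ?A (y 0) + C1"
    using wnorm_diff_le[OF psd(1), of "y 0" Y] Y_le by linarith
  have nonneg: "0 \<le> wnorm ?A v" for v
    using psd(1) by (simp add: wnorm_def sym_psd_def)
  have yk_le: "wnorm ?A (y k - Y) \<le> C2"
  proof -
    \<comment> \<open>The other two terms of \<open>V k\<close> are nonnegative and are dropped;
      those of \<open>V 0\<close> remain and make up \<open>C2\<close>.\<close>
    have "(wnorm ?A (y k - Y))\<^sup>2 \<le> V k"
      using sqrt_range_proj_nonneg[OF psd(3), of "z k - z\<^sub>s"] \<open>\<rho> > 0\<close> \<open>\<alpha> > 0\<close>
      by (simp add: V_def wnorm_power2[OF psd(1)])
    also note V_le
    also have "V 0 = (wnorm ?A (y 0 - Y))\<^sup>2 + \<alpha> * (norm (x 0 - x\<^sub>s))\<^sup>2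
        + 1/\<rho> * (wnorm (pinv ?Ht) (?S *v z 0 - ?S *v z\<^sub>s))\<^sup>2"
      unfolding V_def \<open>S\<^sub>H\<^sub>t = psd_sqrt ?Ht\<close> matrix_vector_mult_diff_distrib[symmetric]
        wnorm_pinv_sqrt[OF psd(3)] wnorm_power2[OF psd(1)] power2_norm_eq_inner ..
    also have "\<dots> \<le> (wnorm ?A (y 0) + C1)\<^sup>2 + \<alpha> * (norm (x 0 - x\<^sub>s))\<^sup>2
        + 1/\<rho> * (wnorm (pinv ?Ht) (?S *v z 0 - ?S *v z\<^sub>s))\<^sup>2"
      using y0_le nonneg by (intro add_mono order_refl power_mono)
    finally show ?thesis
      unfolding \<open>C2 = _\<close> by (rule real_le_rsqrt)
  qed
  have y_diff_le: "wnorm ?A (y k - y 0) \<le> wnorm ?A (y 0) + C1 + C2"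
    using wnorm_diff_le[OF psd(1), of "y k - Y" "y 0 - Y"] yk_le y0_le by simp

  \<comment> \<open>Telescoping the sum over the agents\<close>
  define T where "T = block_sum (?A *v (y k - y 0))"
  have step: "block_sum (?G (x (Suc j))) = block_sum (?A *v y (Suc j)) - block_sum (?A *v y j) - block_sum (s j)" for j
    unfolding G_eq by (simp add: block_sum_linear block_sum_H block_sum_S matrix_vector_mult_diff_distrib)
  have telescope: "(\<Sum>l=1..k. block_sum (?G (x l))) = T - (\<Sum>j<k. block_sum (s j))"
  proof -
    have "(\<Sum>l=1..n. block_sum (?G (x l))) = block_sum (?A *v (y n - y 0)) - (\<Sum>j<n. block_sum (s j))" for n
      by (induction n) (simp_all add: step matrix_vector_mult_diff_distrib block_sum_linear algebra_simps)
    then show ?thesis by (simp add: T_def)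
  qed
  \<comment> \<open>The starting point \<open>x 0\<close> need not lie in the constraint sets, which
    is harmless because the running average begins at index 1.\<close>
  have x_in: "x l $ i \<in> X i" if "l \<in> {1..k}" for l i
    using x_mem[of "l - 1"] that by (simp add: blocks_def)
  let ?avg = "running_avg x k"
  have g_le: "real k * agent_sum g ?avg $ a \<le> T $ Inl a" for a
  proof -
    have "real k * agent_sum g ?avg $ a \<le> real k * (\<Sum>i\<in>UNIV. 1 / real k * (\<Sum>l=1..k. g i (x l $ i) $ a))"
      unfolding agent_sum_def sum_component running_avg_nth
      by (intro mult_left_mono sum_mono convex_on_running_avg_le[OF assms(6)] x_in \<open>k \<ge> 1\<close>) auto
    also have "\<dots> = (\<Sum>i\<in>UNIV. \<Sum>l=1..k. g i (x l $ i) $ a)"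
      using \<open>k \<ge> 1\<close> by (simp flip: sum_divide_distrib)
    also have "\<dots> = (\<Sum>l=1..k. block_sum (?G (x l))) $ Inl a"
      by (subst sum.swap) (simp add: block_sum_def g_tilde_Inl)
    \<comment> \<open>The accumulated slack is nonnegative on inequality coordinates; on equality
      coordinates it is zero, which gives the equality in \<open>h_eq\<close>.\<close>
    also have "\<dots> \<le> T $ Inl a"
      unfolding telescope using dual(2) by (simp add: block_sum_def dual_cone_def sum_nonneg)
    finally show ?thesis .
  qed
  have h_eq: "real k * agent_sum h ?avg $ b = T $ Inr b" for b
  proof -
    have "h i (running_avg (\<lambda>l. x l $ i) k) = (1 / real k) *\<^sub>R (\<Sum>l=1..k. h i (x l $ i))" for i
      by (rule affine_map_on_running_avg[OF assms(7,4) _ \<open>k \<ge> 1\<close>]) (rule x_in)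
    then have "real k * agent_sum h ?avg $ b = real k * (\<Sum>i\<in>UNIV. 1 / real k * (\<Sum>l=1..k. h i (x l $ i) $ b))"
      unfolding agent_sum_def sum_component running_avg_nth
      by simp
    also have "\<dots> = (\<Sum>i\<in>UNIV. \<Sum>l=1..k. h i (x l $ i) $ b)"
      using \<open>k \<ge> 1\<close> by (simp flip: sum_divide_distrib)
    also have "\<dots> = (\<Sum>l=1..k. block_sum (?G (x l))) $ Inr b"
      by (subst sum.swap) (simp add: block_sum_def g_tilde_Inr)
    also have "\<dots> = T $ Inr b"
      unfolding telescope using dual(3) by (simp add: block_sum_def)
    finally show ?thesis .
  qed
  \<comment> \<open>Where the positive part is nonzero it is bounded by the corresponding entry of
    \<open>T\<close>; elsewhere the entry on the left is zero.\<close>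
  have "norm (real k *\<^sub>R stack (pos_part (agent_sum g ?avg)) (agent_sum h ?avg)) \<le> norm T"
  proof (rule norm_le_componentwise_cart)
    fix c :: "'m + 'p"
    show "norm ((real k *\<^sub>R stack (pos_part (agent_sum g ?avg)) (agent_sum h ?avg)) $ c) \<le> norm (T $ c)"
    proof (cases c)
      case (Inl a)
      then show ?thesis
        using g_le[of a] by (auto simp: stack_def pos_part_def max_def)
    next
      case (Inr b)
      then show ?thesis using h_eq[of b] by (simp add: stack_def)
    qed
  qed
  also have "norm T \<le> K * wnorm ?A (y k - y 0)"
    unfolding T_def K_def by (rule norm_block_sum_lift_mat_le[OF \<open>sym_psd P\<^sub>A\<close>])
  also have "\<dots> \<le> K * (wnorm ?A (y 0) + C1 + C2)"
    using y_diff_le max_eigenvalue_nonneg[OF \<open>sym_psd P\<^sub>A\<close>]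
    by (intro mult_left_mono) (auto simp: K_def)
  finally show ?thesis
    using \<open>k \<ge> 1\<close> by (simp add: K_def field_simps)
qed

end
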